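(* Let $d\ge2$, let $\Omega\subset\mathbb{R}^d$ be a bounded open connected set, and for $\delta>0$ let $\alpha_\delta$ be the kernels described in the context. Let $u\in C^4(\Omega)\cap W^{4,\infty}(\Omega)$, and let $\mathcal{L}_{\alpha_\delta}$ be the nonlocal Laplacian scaled with $\sigma=2d$. Then there is a constant $K(u,d)>0$, depending only on $u$ and $d$, such that $$|\mathcal{L}_{\alpha_\delta}[u](x)-\Delta u(x)|\le K(u,d)\,\delta^2\quad\text{whenever }B_\delta(x)\subset\Omega .$$ In addition, $$\sup_{x\in\Omega_\delta}|\mathcal{L}_{\alpha_\delta}[u](x)|\le\|\Delta u\|_{L^\infty(\Omega)}+K(u,d)\,\delta^2,$$ so that, as $\delta\to0$, $\chi_{\Omega_\delta}\mathcal{L}_{\alpha_\delta}[u]\to\Delta u$ strongly in $L^2(\Omega)$. Moreover, if $\operatorname{supp}u\subset\subset\Omega$ and $\delta<\tfrac12\operatorname{dist}(\operatorname{supp}u,\partial\Omega)$, then $$\sup_{x\in\Omega}|\mathcal{L}_{\alpha_\delta}[u](x)|\le\|\Delta u\|_{L^\infty(\Omega)}+K(u,d)\operatorname{dist}(\operatorname{supp}u,\partial\Omega)^2,$$ and hence, as $\delta\to0$, $\mathcal{L}_{\alpha_\delta}[u]\to\Delta u$ strongly in $L^2(\Omega)$.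
   Context: Kernels: for each $\delta>0$, $\rho_\delta\in C^\infty([0,\infty);[0,\infty))$ satisfies $\int_{\mathbb{R}^d}\rho_\delta(|x|)\,dx=1$ and $\operatorname{supp}\rho_\delta\subset[0,\delta)$; $\alpha_\delta(x,y)=\frac{\sqrt{\rho_\delta(|x-y|)}}{|x-y|^2}(x-y)$ and $\mu_\delta(x,y)=|\alpha_\delta(x,y)|^2=\rho_\delta(|x-y|)/|x-y|^2$. Scaled nonlocal Laplacian: $\mathcal{L}_{\alpha_\delta}[u](x)=\sigma\int_\Omega(u(y)-u(x))\mu_\delta(x,y)\,dy$ with $\sigma=2d$. $\Omega_\delta=\{x\in\Omega:\operatorname{dist}(x,\partial\Omega)>\delta\}$; $\chi_{\Omega_\delta}$ is its characteristic function; $B_\delta(x)$ is the open ball of radius $\delta$ about $x$. *)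

theory Defs
  imports "HOL-Analysis.Analysis" "HOL-Probability.Essential_Supremum"
begin

section \<open>Classical derivatives\<close>

definition pderiv_along :: "'a::euclidean_space \<Rightarrow> ('a \<Rightarrow> real) \<Rightarrow> 'a \<Rightarrow> real" where
  "pderiv_along b f x = frechet_derivative f (at x) b"

primrec iter_pderiv :: "'a::euclidean_space list \<Rightarrow> ('a \<Rightarrow> real) \<Rightarrow> 'a \<Rightarrow> real" where
  "iter_pderiv [] f = f"
| "iter_pderiv (b # bs) f = pderiv_along b (iter_pderiv bs f)"

text \<open>The class \<open>C\<^sup>k(\<Omega>)\<close>, meant for open \<open>\<Omega>\<close>; it does not depend on the values outside \<open>\<Omega>\<close>.\<close>

primrec Ck_on :: "nat \<Rightarrow> 'a::euclidean_space set \<Rightarrow> ('a \<Rightarrow> real) \<Rightarrow> bool" where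
  "Ck_on 0 \<Omega> f \<longleftrightarrow> continuous_on \<Omega> f"
| "Ck_on (Suc k) \<Omega> f \<longleftrightarrow>
     (\<forall>x\<in>\<Omega>. f differentiable (at x)) \<and> (\<forall>b\<in>Basis. Ck_on k \<Omega> (pderiv_along b f))"

definition laplacian :: "('a::euclidean_space \<Rightarrow> real) \<Rightarrow> 'a \<Rightarrow> real" where
  "laplacian f x = (\<Sum>b\<in>Basis. iter_pderiv [b, b] f x)"

text \<open>\<open>C\<^sup>\<infinity>([0,\<infinity>))\<close>: derivatives of all orders exist, one-sided ones at the endpoint \<open>0\<close>.\<close>

definition smooth_halfline :: "(real \<Rightarrow> real) \<Rightarrow> bool" where
  "smooth_halfline r \<longleftrightarrow>
     (\<exists>D :: nat \<Rightarrow> real \<Rightarrow> real. (\<forall>t\<ge>0. D 0 t = r t) \<and>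
        (\<forall>k. \<forall>t\<ge>0. (D k has_real_derivative D (Suc k) t) (at t within {0..})))"


section \<open>Function spaces\<close>

definition supp_on :: "'a::euclidean_space set \<Rightarrow> ('a \<Rightarrow> real) \<Rightarrow> 'a set" where
  "supp_on \<Omega> f = closure {x\<in>\<Omega>. f x \<noteq> 0}"

definition compactly_supported_in :: "'a::euclidean_space set \<Rightarrow> ('a \<Rightarrow> real) \<Rightarrow> bool" where
  "compactly_supported_in \<Omega> f \<longleftrightarrow> compact (supp_on \<Omega> f) \<and> supp_on \<Omega> f \<subseteq> \<Omega>"

text \<open>\<open>C\<^sub>c\<^sup>\<infinity>(\<Omega>)\<close>, its elements being extended by zero to the whole space.\<close>

definition test_function :: "'a::euclidean_space set \<Rightarrow> ('a \<Rightarrow> real) \<Rightarrow> bool" where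
  "test_function \<Omega> \<phi> \<longleftrightarrow>
     (\<forall>k. Ck_on k UNIV \<phi>) \<and> compact (supp_on UNIV \<phi>) \<and> supp_on UNIV \<phi> \<subseteq> \<Omega>"

definition Linfty_norm :: "'a::euclidean_space set \<Rightarrow> ('a \<Rightarrow> real) \<Rightarrow> ennreal" where
  "Linfty_norm \<Omega> f = esssup (lebesgue_on \<Omega>) (\<lambda>x. ennreal \<bar>f x\<bar>)"

definition Linfty :: "'a::euclidean_space set \<Rightarrow> ('a \<Rightarrow> real) set" where
  "Linfty \<Omega> = {f. f \<in> borel_measurable (lebesgue_on \<Omega>) \<and> Linfty_norm \<Omega> f < \<infinity>}"

text \<open>A list of basis vectors plays the role of a multi-index. Local integrability is not
  demanded, since the definition is only used for \<open>u\<close> and \<open>g\<close> in \<open>L\<^sup>\<infinity>(\<Omega>)\<close>.\<close>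

definition weak_pderiv ::
  "'a::euclidean_space set \<Rightarrow> 'a list \<Rightarrow> ('a \<Rightarrow> real) \<Rightarrow> ('a \<Rightarrow> real) \<Rightarrow> bool" where
  "weak_pderiv \<Omega> bs u g \<longleftrightarrow>
     (\<forall>\<phi>. test_function \<Omega> \<phi> \<longrightarrow>
        (LINT x:\<Omega>|lebesgue. u x * iter_pderiv bs \<phi> x)
          = (-1) ^ length bs * (LINT x:\<Omega>|lebesgue. g x * \<phi> x))"

definition W_infty :: "nat \<Rightarrow> 'a::euclidean_space set \<Rightarrow> ('a \<Rightarrow> real) set" where
  "W_infty k \<Omega> = {u \<in> Linfty \<Omega>. \<forall>bs. set bs \<subseteq> Basis \<and> length bs \<le> k \<longrightarrow>
                     (\<exists>g \<in> Linfty \<Omega>. weak_pderiv \<Omega> bs u g)}"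

definition L2 :: "'a::euclidean_space set \<Rightarrow> ('a \<Rightarrow> real) set" where
  "L2 \<Omega> = {f. f \<in> borel_measurable (lebesgue_on \<Omega>) \<and> integrable (lebesgue_on \<Omega>) (\<lambda>x. (f x)\<^sup>2)}"

definition L2_norm :: "'a::euclidean_space set \<Rightarrow> ('a \<Rightarrow> real) \<Rightarrow> real" where
  "L2_norm \<Omega> f = sqrt (LINT x|lebesgue_on \<Omega>. (f x)\<^sup>2)"

text \<open>Strong convergence in \<open>L\<^sup>2(\<Omega>)\<close> of a family indexed by \<open>\<delta> > 0\<close>, as \<open>\<delta> \<rightarrow> 0\<close>. Membership
  in \<open>L\<^sup>2\<close> is demanded because the Bochner integral of a non-integrable function is \<open>0\<close>.\<close>

definition converges_L2 ::
  "'a::euclidean_space set \<Rightarrow> (real \<Rightarrow> 'a \<Rightarrow> real) \<Rightarrow> ('a \<Rightarrow> real) \<Rightarrow> bool" where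
  "converges_L2 \<Omega> f g \<longleftrightarrow>
     g \<in> L2 \<Omega> \<and> (\<forall>\<^sub>F \<delta> in at_right 0. f \<delta> \<in> L2 \<Omega>) \<and>
     ((\<lambda>\<delta>. L2_norm \<Omega> (\<lambda>x. f \<delta> x - g x)) \<longlongrightarrow> 0) (at_right 0)"


section \<open>Distances\<close>

text \<open>Unlike \<^const>\<open>setdist\<close>, this is \<open>\<infinity>\<close> (the infimum of the empty set) if one of the sets
  is empty; this matters for the support of \<open>u = 0\<close>.\<close>

definition set_edist :: "'a::metric_space set \<Rightarrow> 'a set \<Rightarrow> ennreal" where
  "set_edist A B = (INF (x, y) \<in> A \<times> B. ennreal (dist x y))"

definition inner_domain :: "'a::euclidean_space set \<Rightarrow> real \<Rightarrow> 'a set" where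
  "inner_domain \<Omega> \<delta> = {x\<in>\<Omega>. infdist x (frontier \<Omega>) > \<delta>}"


section \<open>Kernels and the nonlocal Laplacian\<close>

text \<open>The type argument determines the space over which the profile is normalised.\<close>

definition kernel_profile :: "'a::euclidean_space itself \<Rightarrow> real \<Rightarrow> (real \<Rightarrow> real) \<Rightarrow> bool" where
  "kernel_profile T \<delta> r \<longleftrightarrow>
     smooth_halfline r \<and> (\<forall>t\<ge>0. r t \<ge> 0) \<and>
     (LINT x|(lebesgue :: 'a measure). r (norm x)) = 1 \<and>
     closure {t. t \<ge> 0 \<and> r t \<noteq> 0} \<subseteq> {0..<\<delta>}"

definition kernel_alpha :: "(real \<Rightarrow> real) \<Rightarrow> 'a::euclidean_space \<Rightarrow> 'a \<Rightarrow> 'a" where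
  "kernel_alpha r x y = (sqrt (r (norm (x - y))) / (norm (x - y))\<^sup>2) *\<^sub>R (x - y)"

definition nonlocal_laplacian ::
  "real \<Rightarrow> 'a::euclidean_space set \<Rightarrow> ('a \<Rightarrow> 'a \<Rightarrow> 'a) \<Rightarrow> ('a \<Rightarrow> real) \<Rightarrow> 'a \<Rightarrow> real" where
  "nonlocal_laplacian \<sigma> \<Omega> \<alpha> u x =
     \<sigma> * (LINT y:\<Omega>|lebesgue. (u y - u x) * (norm (\<alpha> x y))\<^sup>2)"

abbreviation scaled_nonlocal_laplacian ::
  "'a::euclidean_space set \<Rightarrow> (real \<Rightarrow> real) \<Rightarrow> ('a \<Rightarrow> real) \<Rightarrow> 'a \<Rightarrow> real" where
  "scaled_nonlocal_laplacian \<Omega> r \<equiv> nonlocal_laplacian (2 * real DIM('a)) \<Omega> (kernel_alpha r)"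

end

theory Submission
  imports Defs
begin

text \<open>Integrating by parts against smooth bumps shows that the classical derivatives of \<open>u\<close> up to
  order four inherit the \<open>L\<^sup>\<infinity>\<close> bounds of the weak ones. If \<open>B\<^sub>\<delta>(x) \<subseteq> \<Omega>\<close>, averaging the integrand over \<open>z\<close> and \<open>-z\<close> turns the
  nonlocal Laplacian into an integral of \<open>u(x+z) + u(x-z) - 2u(x)\<close> against \<open>\<rho>\<^sub>\<delta>(|z|)/|z|\<^sup>2\<close>. The
  quadratic Taylor term integrates to \<open>\<Delta>u(x)\<close>, since by symmetry the second moments
  of the kernel are \<open>1/d\<close> on the diagonal and \<open>0\<close> off it, and the fourth-order remainder is at most a
  constant times \<open>\<delta>\<^sup>2\<close>. The hypothesis \<open>d \<ge> 2\<close> makes \<open>1/|z|\<close> locally integrable, without which the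
  unsymmetrised integral need not exist. The \<open>L\<^sup>2\<close> limits follow by dominated convergence; if \<open>u\<close> has
  compact support, the nonlocal Laplacian vanishes within \<open>\<delta>\<close> of the boundary for small \<open>\<delta>\<close>.\<close>

section \<open>Iterated partial derivatives\<close>

text \<open>The constant has to be uniform over all kernels, so only derivatives of \<open>u\<close>
  may feed it; a bound for the profile \<open>r\<close> serves integrability alone. The factor d^5
  is d^4 from expanding a fourth directional derivative into partial ones, since the coordinates of
  \<open>z\<close> sum in absolute value to at most d |z|, times the d that is left of sigma = 2d
  after averaging. The power \<delta>^2 appears because |z|^4 meets the kernel's |z|^-2 on |z| <
  \<delta>. Taylor's remainder needs bounds at every point, whereas a weak derivative is bounded
  only almost everywhere. Continuity closes this gap: an excess at one point spreads to a ball,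
  where a bump detects it. The same argument with the function as its own weak partner turns the
  essential supremum of the Laplacian into a bound at each point. Derivatives are indexed by lists
  of basis vectors, and their order is tracked: integration by parts reverses it, so the classical
  derivative along \<open>bs\<close> is paired with the weak one along \<open>rev bs\<close>. As a
  Bochner integral that fails to exist is 0, integrability precedes every splitting of an
  integral.\<close>

lemma frechet_derivative_eq_sum_pderiv_along:
  assumes "f differentiable (at x)"
  shows "frechet_derivative f (at x) z = (\<Sum>b\<in>Basis. (z \<bullet> b) * pderiv_along b f x)"
proof -
  have lin: "linear (frechet_derivative f (at x))"
    by (rule linear_frechet_derivative[OF assms])
  have "frechet_derivative f (at x) (\<Sum>b\<in>Basis. (z \<bullet> b) *\<^sub>R b)
      = (\<Sum>b\<in>Basis. (z \<bullet> b) * pderiv_along b f x)"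
    by (simp add: linear_sum[OF lin] linear_scale[OF lin] pderiv_along_def)
  then show ?thesis by (simp add: euclidean_representation)
qed

lemma Ck_on_SucD: "Ck_on (Suc k) \<Omega> f \<Longrightarrow> Ck_on k \<Omega> f"
proof (induction k arbitrary: f)
  case 0
  then show ?case
    by (auto intro!: continuous_at_imp_continuous_on differentiable_imp_continuous_within)
next
  case (Suc k)
  then show ?case by (metis Ck_on.simps(2))
qed

lemma Ck_on_antimono: "Ck_on n \<Omega> f \<Longrightarrow> k \<le> n \<Longrightarrow> Ck_on k \<Omega> f"
  by (induction n) (auto simp del: Ck_on.simps simp: le_Suc_eq dest: Ck_on_SucD)

lemma Ck_on_iter_pderiv:
  "Ck_on (length bs + k) \<Omega> f \<Longrightarrow> set bs \<subseteq> Basis \<Longrightarrow> Ck_on k \<Omega> (iter_pderiv bs f)"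
proof (induction bs arbitrary: k)
  case (Cons b bs)
  then have "Ck_on (Suc k) \<Omega> (iter_pderiv bs f)"
    using Cons.IH[of "Suc k"] by (simp del: Ck_on.simps)
  with Cons.prems show ?case by simp
qed simp

lemma Ck_on_imp_continuous_on: "Ck_on k \<Omega> f \<Longrightarrow> continuous_on \<Omega> f"
  using Ck_on_antimono[of k \<Omega> f 0] by simp

lemma continuous_on_iter_pderiv:
  "Ck_on k \<Omega> f \<Longrightarrow> length bs \<le> k \<Longrightarrow> set bs \<subseteq> Basis \<Longrightarrow> continuous_on \<Omega> (iter_pderiv bs f)"
  using Ck_on_iter_pderiv[of bs 0 \<Omega> f] Ck_on_antimono[of k \<Omega> f "length bs"] by simp

lemma iter_pderiv_append: "iter_pderiv (as @ bs) f = iter_pderiv as (iter_pderiv bs f)"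
  by (induction as) auto

text \<open>\<open>dir_deriv m z f x\<close> is the \<open>m\<close>-th derivative of \<open>f\<close> at \<open>x\<close> in direction \<open>z\<close>, spelled out
  in partial derivatives.\<close>

primrec dir_deriv :: "nat \<Rightarrow> 'a::euclidean_space \<Rightarrow> ('a \<Rightarrow> real) \<Rightarrow> 'a \<Rightarrow> real" where
  "dir_deriv 0 z f x = f x"
| "dir_deriv (Suc m) z f x = (\<Sum>b\<in>Basis. (z \<bullet> b) * dir_deriv m z (pderiv_along b f) x)"

text \<open>The recursion of \<open>dir_deriv\<close> differentiates \<open>f\<close> itself first,
  so the induction passes from \<open>f\<close> to \<open>pderiv_along b f\<close>, and the chain
  rule is met only in the base case.\<close>

lemma has_real_derivative_dir_deriv:
  assumes "Ck_on (Suc m) \<Omega> f" "x + t *\<^sub>R z \<in> \<Omega>"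
  shows "((\<lambda>s. dir_deriv m z f (x + s *\<^sub>R z)) has_real_derivative
    dir_deriv (Suc m) z f (x + t *\<^sub>R z)) (at t)"
  using assms
proof (induction m arbitrary: f)
  case 0
  then have d: "f differentiable (at (x + t *\<^sub>R z))" by simp
  have "((f \<circ> (\<lambda>s. x + s *\<^sub>R z)) has_derivative
      frechet_derivative f (at (x + t *\<^sub>R z)) \<circ> (\<lambda>s. s *\<^sub>R z)) (at t)"
  proof (rule diff_chain_at)
    show "((\<lambda>s. x + s *\<^sub>R z) has_derivative (\<lambda>s. s *\<^sub>R z)) (at t)"
      by (auto intro!: derivative_eq_intros)
    show "(f has_derivative frechet_derivative f (at (x + t *\<^sub>R z))) (at (x + t *\<^sub>R z))"
      using d by (simp add: frechet_derivative_works)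
  qed
  moreover have "frechet_derivative f (at (x + t *\<^sub>R z)) \<circ> (\<lambda>s. s *\<^sub>R z)
      = (*) (frechet_derivative f (at (x + t *\<^sub>R z)) z)"
    using linear_scale[OF linear_frechet_derivative[OF d]] by (auto simp: o_def)
  ultimately show ?case
    by (simp add: has_field_derivative_def o_def frechet_derivative_eq_sum_pderiv_along[OF d])
next
  case (Suc m)
  have "((\<lambda>s. dir_deriv m z (pderiv_along b f) (x + s *\<^sub>R z)) has_real_derivative
      dir_deriv (Suc m) z (pderiv_along b f) (x + t *\<^sub>R z)) (at t)" if "b \<in> Basis" for b
    using Suc.prems that by (intro Suc.IH) auto
  then have "((\<lambda>s. \<Sum>b\<in>Basis. (z \<bullet> b) * dir_deriv m z (pderiv_along b f) (x + s *\<^sub>R z))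
     has_real_derivative
     (\<Sum>b\<in>Basis. (z \<bullet> b) * dir_deriv (Suc m) z (pderiv_along b f) (x + t *\<^sub>R z))) (at t)"
    by (intro DERIV_sum DERIV_cmult)
  then show ?case by simp
qed

lemma sum_abs_inner_Basis_le: "(\<Sum>b\<in>Basis. \<bar>z \<bullet> b\<bar>) \<le> real DIM('a) * norm (z::'a::euclidean_space)"
  using sum_bounded_above[of Basis "\<lambda>b. \<bar>z \<bullet> b\<bar>" "norm z"] by (simp add: Basis_le_norm)

lemma abs_dir_deriv_le:
  fixes z :: "'a::euclidean_space"
  assumes "\<And>bs. set bs \<subseteq> Basis \<Longrightarrow> length bs = m \<Longrightarrow> \<bar>iter_pderiv bs f y\<bar> \<le> M"
  shows "\<bar>dir_deriv m z f y\<bar> \<le> (real DIM('a) * norm z) ^ m * M"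
  using assms
proof (induction m arbitrary: f)
  case 0
  then show ?case by force
next
  case (Suc m)
  have *: "\<bar>dir_deriv m z (pderiv_along b f) y\<bar> \<le> (real DIM('a) * norm z) ^ m * M" if "b \<in> Basis" for b
  proof (rule Suc.IH)
    fix bs :: "'a list" assume "set bs \<subseteq> Basis" "length bs = m"
    \<comment> \<open>The last entry of a list acts first, so derivatives of
      \<open>pderiv_along b f\<close> along \<open>bs\<close> are those of \<open>f\<close> along
      \<open>bs @ [b]\<close>.\<close>
    then show "\<bar>iter_pderiv bs (pderiv_along b f) y\<bar> \<le> M"
      using Suc.prems[of "bs @ [b]"] that by (simp add: iter_pderiv_append)
  qed
  \<comment> \<open>The sign of \<open>M\<close> is not assumed; the right-hand side is nonnegative
    because it bounds an absolute value for at least one basis vector.\<close>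
  obtain b :: 'a where "b \<in> Basis" using nonempty_Basis by blast
  then have nn: "0 \<le> (real DIM('a) * norm z) ^ m * M"
    using *[of b] by linarith
  have "\<bar>dir_deriv (Suc m) z f y\<bar> \<le> (\<Sum>b\<in>Basis. \<bar>z \<bullet> b\<bar> * \<bar>dir_deriv m z (pderiv_along b f) y\<bar>)"
    by (simp add: sum_abs flip: abs_mult)
  also have "\<dots> \<le> (\<Sum>b\<in>Basis. \<bar>z \<bullet> b\<bar> * ((real DIM('a) * norm z) ^ m * M))"
    by (intro sum_mono mult_left_mono *) auto
  also have "\<dots> = (\<Sum>b\<in>Basis. \<bar>z \<bullet> b\<bar>) * ((real DIM('a) * norm z) ^ m * M)"
    by (simp add: sum_distrib_right)
  also have "\<dots> \<le> (real DIM('a) * norm z) * ((real DIM('a) * norm z) ^ m * M)"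
    by (intro mult_right_mono sum_abs_inner_Basis_le nn)
  finally show ?case by (simp add: mult_ac)
qed

lemma dir_deriv_2:
  "dir_deriv 2 z f x = (\<Sum>b\<in>Basis. \<Sum>c\<in>Basis. (z \<bullet> b) * (z \<bullet> c) * iter_pderiv [c, b] f x)"
  by (simp add: numeral_2_eq_2 sum_distrib_left mult_ac)

text \<open>Mean value theorem along the segment. The factor |z| gained here lowers the kernel's
  singularity from |z|^-2 to |z|^-1.\<close>

lemma abs_diff_le_of_pderiv_bound:
  fixes z :: "'a::euclidean_space"
  assumes "Ck_on 1 \<Omega> f" "\<And>t. 0 \<le> t \<Longrightarrow> t \<le> 1 \<Longrightarrow> x + t *\<^sub>R z \<in> \<Omega>"
    and M: "\<And>bs y. set bs \<subseteq> Basis \<Longrightarrow> length bs = 1 \<Longrightarrow> y \<in> \<Omega> \<Longrightarrow> \<bar>iter_pderiv bs f y\<bar> \<le> M"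
  shows "\<bar>f (x + z) - f x\<bar> \<le> real DIM('a) * norm z * M"
proof -
  have "((\<lambda>s. dir_deriv 0 z f (x + s *\<^sub>R z)) has_real_derivative
      dir_deriv (Suc 0) z f (x + t *\<^sub>R z)) (at t)" if "0 \<le> t" "t \<le> 1" for t
    using assms that by (intro has_real_derivative_dir_deriv[of _ \<Omega>]) auto
  then obtain t where t: "0 < t" "t < 1"
    "dir_deriv 0 z f (x + 1 *\<^sub>R z) - dir_deriv 0 z f (x + 0 *\<^sub>R z)
      = (1 - 0) * dir_deriv (Suc 0) z f (x + t *\<^sub>R z)"
    using MVT2[of 0 1 "\<lambda>s. dir_deriv 0 z f (x + s *\<^sub>R z)"
        "\<lambda>t. dir_deriv (Suc 0) z f (x + t *\<^sub>R z)"] by auto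
  have "\<bar>dir_deriv (Suc 0) z f (x + t *\<^sub>R z)\<bar> \<le> (real DIM('a) * norm z) ^ Suc 0 * M"
    using assms(2)[of t] t by (intro abs_dir_deriv_le M) auto
  with t(3) show ?thesis by simp
qed

text \<open>Taylor's formula of order four along the line, from 0 to 1 and from 0 to -1: on adding,
  the terms of orders 1 and 3 cancel.\<close>

lemma abs_second_difference_le:
  fixes z :: "'a::euclidean_space"
  assumes C: "Ck_on 4 \<Omega> f" and seg: "\<And>t. \<bar>t\<bar> \<le> 1 \<Longrightarrow> x + t *\<^sub>R z \<in> \<Omega>"
    and M: "\<And>bs y. set bs \<subseteq> Basis \<Longrightarrow> length bs = 4 \<Longrightarrow> y \<in> \<Omega> \<Longrightarrow> \<bar>iter_pderiv bs f y\<bar> \<le> M"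
  shows "\<bar>f (x + z) + f (x - z) - 2 * f x - dir_deriv 2 z f x\<bar> \<le> (real DIM('a) * norm z) ^ 4 * M"
proof -
  define D where "D m t = dir_deriv m z f (x + t *\<^sub>R z)" for m t
  have D: "\<forall>m t. m < 4 \<and> - 1 \<le> t \<and> t \<le> 1 \<longrightarrow> DERIV (D m) t :> D (Suc m) t"
    unfolding D_def using seg Ck_on_antimono[OF C]
    by (auto intro!: has_real_derivative_dir_deriv[of _ \<Omega>] simp del: Ck_on.simps dir_deriv.simps)
  have B: "\<bar>D 4 t\<bar> \<le> (real DIM('a) * norm z) ^ 4 * M" if "\<bar>t\<bar> \<le> 1" for t
    unfolding D_def using seg[OF that] by (intro abs_dir_deriv_le M) auto
  obtain s where s: "0 < s" "s < 1" "D 0 1 = (\<Sum>m<4. D m 0 / fact m * (1 - 0) ^ m) + D 4 s / fact 4 * (1 - 0) ^ 4"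
    using Taylor[of 4 D "D 0" "-1" 1 0 1] D by auto
  obtain t where t: "-1 < t" "t < 0"
    "D 0 (-1) = (\<Sum>m<4. D m 0 / fact m * (-1 - 0) ^ m) + D 4 t / fact 4 * (-1 - 0) ^ 4"
    using Taylor[of 4 D "D 0" "-1" 1 0 "-1"] D by auto
  have "D 0 1 + D 0 (-1) = 2 * D 0 0 + D 2 0 + (D 4 s + D 4 t) / 24"
    unfolding s(3) t(3) by (simp add: eval_nat_numeral)
  then have "f (x + z) + f (x - z) - 2 * f x - dir_deriv 2 z f x = (D 4 s + D 4 t) / 24"
    by (simp add: D_def)
  \<comment> \<open>Division by 24 would leave a factor 1/12, which is given away.\<close>
  moreover have "\<bar>D 4 s + D 4 t\<bar> \<le> 2 * ((real DIM('a) * norm z) ^ 4 * M)"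
    using B[of s] B[of t] s t by linarith
  moreover have "0 \<le> (real DIM('a) * norm z) ^ 4 * M" using B[of 0] by auto
  ultimately show ?thesis by auto
qed

section \<open>Bump functions\<close>

text \<open>The classical flat function exp(-1/t). The negative powers of \<open>t\<close> are built
  in so that the family is closed under differentiation up to linear combinations.\<close>

definition flat_exp :: "nat \<Rightarrow> real \<Rightarrow> real" where
  "flat_exp n t = (if t > 0 then exp (- 1 / t) / t ^ n else 0)"

text \<open>A single term of the series of exp(1/t), the one of order n + 2, already beats t^-n by a
  factor t^2; this yields the derivative 0 at the origin.\<close>

lemma abs_flat_exp_le: "\<bar>flat_exp n t\<bar> \<le> fact (n + 2) * t\<^sup>2"
proof (cases "t > 0")
  case True
  have "(\<Sum>k\<in>{n + 2}. (1 / t) ^ k /\<^sub>R fact k) \<le> (\<Sum>k. (1 / t) ^ k /\<^sub>R fact k)"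
    using True by (intro sum_le_suminf summable_exp_generic) auto
  then have "(1 / t) ^ (n + 2) / fact (n + 2) \<le> exp (1 / t)"
    by (simp add: exp_def divide_inverse mult_ac)
  then have "1 \<le> exp (1 / t) * fact (n + 2) * t ^ (n + 2)"
    using True by (simp add: power_divide field_simps del: fact_Suc)
  then show ?thesis
    using True by (simp add: flat_exp_def exp_minus field_simps power_add power2_eq_square del: fact_Suc)
qed (simp add: flat_exp_def)

lemma DERIV_flat_exp:
  "(flat_exp n has_real_derivative flat_exp (n + 2) t - real n * flat_exp (n + 1) t) (at t)"
proof -
  consider "t > 0" | "t < 0" | "t = 0" by linarith
  then show ?thesis
  proof cases
    case 1
    \<comment> \<open>The form n t^n / t avoids the truncated exponent n - 1 at n = 0.\<close>
    have "((\<lambda>t. t ^ n) has_real_derivative real n * t ^ n / t) (at t)"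
      using 1 DERIV_pow[of n t UNIV] by (cases n) auto
    moreover have "((\<lambda>t. exp (- 1 / t)) has_real_derivative exp (- 1 / t) / t\<^sup>2) (at t)"
      using 1 by (auto intro!: derivative_eq_intros simp: power2_eq_square)
    ultimately have "((\<lambda>t. exp (- 1 / t) / t ^ n) has_real_derivative
        (exp (- 1 / t) / t\<^sup>2 * t ^ n - exp (- 1 / t) * (real n * t ^ n / t)) / (t ^ n * t ^ n)) (at t)"
      using 1 by (intro DERIV_divide) auto
    also have "(exp (- 1 / t) / t\<^sup>2 * t ^ n - exp (- 1 / t) * (real n * t ^ n / t)) / (t ^ n * t ^ n)
        = flat_exp (n + 2) t - real n * flat_exp (n + 1) t"
      using 1 by (simp add: flat_exp_def divide_simps power_add power2_eq_square) algebra
    finally have "((\<lambda>t. exp (- 1 / t) / t ^ n) has_real_derivative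
        flat_exp (n + 2) t - real n * flat_exp (n + 1) t) (at t)" .
    then show ?thesis
      by (rule has_field_derivative_transform_within_open[of _ _ _ "{0<..}"])
        (use 1 in \<open>auto simp: flat_exp_def\<close>)
  next
    case 2
    have "((\<lambda>t. 0) has_real_derivative
        flat_exp (n + 2) t - real n * flat_exp (n + 1) t) (at t)"
      using 2 by (auto simp: flat_exp_def)
    then show ?thesis
      by (rule has_field_derivative_transform_within_open[of _ _ _ "{..<0}"])
        (use 2 in \<open>auto simp: flat_exp_def\<close>)
  next
    case 3
    \<comment> \<open>By the quadratic bound the difference quotient is O(|h|), and the claimed
      formula also gives 0 at the origin.\<close>
    have "((\<lambda>h. flat_exp n h / h) \<longlongrightarrow> 0) (at 0)"
    proof (rule Lim_null_comparison)
      show "\<forall>\<^sub>F h in at 0. norm (flat_exp n h / h) \<le> fact (n + 2) * \<bar>h\<bar>"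
      proof (intro always_eventually allI)
        fix h :: real
        have "\<bar>flat_exp n h\<bar> \<le> fact (n + 2) * \<bar>h\<bar> * \<bar>h\<bar>"
          using abs_flat_exp_le[of n h] by (simp add: power2_eq_square mult.assoc del: fact_Suc)
        then show "norm (flat_exp n h / h) \<le> fact (n + 2) * \<bar>h\<bar>"
          by (cases "h = 0") (simp_all add: divide_le_eq del: fact_Suc)
      qed
      show "((\<lambda>h::real. fact (n + 2) * \<bar>h\<bar>) \<longlongrightarrow> 0) (at 0)"
        by (auto intro!: tendsto_eq_intros simp del: fact_Suc)
    qed
    then show ?thesis
      using 3 by (simp add: has_field_derivative_iff flat_exp_def)
  qed
qed

text \<open>This algebra is closed under partial derivatives, which makes the smoothness of the bump a
  plain induction.\<close>

inductive_set bump_algebra :: "'a::euclidean_space \<Rightarrow> real \<Rightarrow> ('a \<Rightarrow> real) set" for a r where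
  const: "(\<lambda>x. c) \<in> bump_algebra a r"
| inner: "(\<lambda>x. x \<bullet> v) \<in> bump_algebra a r"
| flat: "(\<lambda>x. flat_exp n (r\<^sup>2 - (x - a) \<bullet> (x - a))) \<in> bump_algebra a r"
| add: "f \<in> bump_algebra a r \<Longrightarrow> g \<in> bump_algebra a r \<Longrightarrow> (\<lambda>x. f x + g x) \<in> bump_algebra a r"
| mult: "f \<in> bump_algebra a r \<Longrightarrow> g \<in> bump_algebra a r \<Longrightarrow> (\<lambda>x. f x * g x) \<in> bump_algebra a r"

lemma bump_algebra_has_derivative:
  "f \<in> bump_algebra a r \<Longrightarrow>
    \<exists>f'. (\<forall>x. (f has_derivative f' x) (at x)) \<and> (\<forall>v. (\<lambda>x. f' x v) \<in> bump_algebra a r)"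
proof (induction rule: bump_algebra.induct)
  case (const c)
  show ?case by (rule exI[of _ "\<lambda>x v. 0"]) (auto intro: bump_algebra.const)
next
  case (inner v)
  show ?case by (rule exI[of _ "\<lambda>x w. w \<bullet> v"])
    (auto intro: bump_algebra.const intro!: derivative_eq_intros)
next
  case (flat n)
  let ?s = "\<lambda>x. r\<^sup>2 - (x - a) \<bullet> (x - a)"
  \<comment> \<open>The derivative is spelled with sums and constant factors in place of
    differences, so that it matches the closure rules of \<open>bump_algebra\<close>
    literally.\<close>
  let ?D = "\<lambda>x v. (flat_exp (n + 2) (?s x) + (- real n) * flat_exp (n + 1) (?s x))
      * ((- 2) * (x \<bullet> v + (- (a \<bullet> v))))"
  have "((\<lambda>x. flat_exp n (?s x)) has_derivative ?D x) (at x)" for x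
  proof -
    have "(?s has_derivative (\<lambda>v. - 2 * ((x - a) \<bullet> v))) (at x)"
      by (auto intro!: derivative_eq_intros simp: inner_commute)
    from DERIV_compose_FDERIV[OF DERIV_flat_exp this, of n]
    show ?thesis
      by (simp add: inner_diff_left algebra_simps)
  qed
  moreover have "(\<lambda>x. ?D x v) \<in> bump_algebra a r" for v
    by (intro bump_algebra.intros)
  ultimately show ?case by (intro exI[of _ ?D]) blast
next
  case (add f g)
  then obtain f' g' where "\<forall>x. (f has_derivative f' x) (at x)" "\<forall>v. (\<lambda>x. f' x v) \<in> bump_algebra a r"
    "\<forall>x. (g has_derivative g' x) (at x)" "\<forall>v. (\<lambda>x. g' x v) \<in> bump_algebra a r" by blast
  then show ?case
    by (intro exI[of _ "\<lambda>x v. f' x v + g' x v"]) (auto intro!: derivative_intros bump_algebra.add)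
next
  case (mult f g)
  then obtain f' g' where "\<forall>x. (f has_derivative f' x) (at x)" "\<forall>v. (\<lambda>x. f' x v) \<in> bump_algebra a r"
    "\<forall>x. (g has_derivative g' x) (at x)" "\<forall>v. (\<lambda>x. g' x v) \<in> bump_algebra a r" by blast
  then show ?case using mult.hyps
    by (intro exI[of _ "\<lambda>x v. f x * g' x v + f' x v * g x"])
      (auto intro!: derivative_eq_intros bump_algebra.add bump_algebra.mult)
qed

lemma bump_algebra_pderiv_along:
  assumes "f \<in> bump_algebra a r"
  shows "f differentiable (at x)" "pderiv_along b f \<in> bump_algebra a r"
proof -
  obtain f' where f': "\<And>x. (f has_derivative f' x) (at x)" "\<And>v. (\<lambda>x. f' x v) \<in> bump_algebra a r"
    using bump_algebra_has_derivative[OF assms] by blast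
  show "f differentiable (at x)" using f'(1) by (auto simp: differentiable_def)
  have "pderiv_along b f = (\<lambda>x. f' x b)"
    using frechet_derivative_at[OF f'(1)] by (auto simp: pderiv_along_def)
  with f'(2) show "pderiv_along b f \<in> bump_algebra a r" by simp
qed

lemma Ck_on_bump_algebra: "f \<in> bump_algebra a r \<Longrightarrow> Ck_on k UNIV f"
proof (induction k arbitrary: f)
  case 0
  then show ?case
    using bump_algebra_pderiv_along(1)
    by (auto intro!: continuous_at_imp_continuous_on differentiable_imp_continuous_within)
qed (auto simp: bump_algebra_pderiv_along)

text \<open>The standard mollifier profile, not normalised. The squared norm, written as an inner
  product, is a polynomial, which keeps the function smooth at the centre.\<close>

definition bump :: "'a::euclidean_space \<Rightarrow> real \<Rightarrow> 'a \<Rightarrow> real" where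
  "bump a r x = flat_exp 0 (r\<^sup>2 - (x - a) \<bullet> (x - a))"

lemma bump_nonneg: "bump a r x \<ge> 0"
  by (simp add: bump_def flat_exp_def)

lemma bump_neq_0_iff: "r > 0 \<Longrightarrow> bump a r x \<noteq> 0 \<longleftrightarrow> x \<in> ball a r"
  by (simp add: bump_def flat_exp_def dist_norm norm_minus_commute abs_le_square_iff
      flip: power2_norm_eq_inner) (metis norm_ge_zero power2_le_imp_le power_mono not_le less_imp_le power_strict_mono zero_less_numeral)

lemma Ck_on_bump: "Ck_on k UNIV (bump a r)"
  using Ck_on_bump_algebra[OF bump_algebra.flat[of 0 r a]] by (simp add: bump_def[abs_def])

lemma test_function_bump:
  assumes "r > 0" "cball a r \<subseteq> \<Omega>"
  shows "test_function \<Omega> (bump a r)"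
proof -
  have "supp_on UNIV (bump a r) = cball a r"
    using assms(1) by (simp add: supp_on_def bump_neq_0_iff del: mem_ball)
  with assms show ?thesis by (simp add: test_function_def Ck_on_bump)
qed

section \<open>Classical derivatives of functions with bounded weak derivatives\<close>

text \<open>Continuity is asked on \<open>S\<close> only, so products cut off by the indicator of an
  open set around \<open>S\<close> qualify.\<close>

lemma integrable_lborel_vanishing_outside_compact:
  fixes f :: "'a::euclidean_space \<Rightarrow> real"
  assumes "compact S" "continuous_on S f" "\<And>x. x \<notin> S \<Longrightarrow> f x = 0"
  shows "integrable lborel f"
proof -
  have "(\<lambda>x. indicator S x *\<^sub>R f x) = f"
    using assms(3) by (auto simp: fun_eq_iff indicator_def)
  with borel_integrable_compact[OF assms(1,2)] show ?thesis by simp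
qed

section \<open>Translation invariance and integration by parts\<close>

lemma lborel_integral_translate:
  fixes f :: "'a::euclidean_space \<Rightarrow> real"
  assumes [measurable]: "f \<in> borel_measurable borel"
  shows "(LINT x|lborel. f (c + x)) = (LINT x|lborel. f x)"
proof -
  have "(LINT x|lborel. f x) = (LINT x|distr lborel borel ((+) c). f x)"
    by (simp add: lborel_distr_plus)
  also have "\<dots> = (LINT x|lborel. f (c + x))"
    by (subst integral_distr) auto
  finally show ?thesis by simp
qed

lemma lborel_integrable_translate:
  fixes f :: "'a::euclidean_space \<Rightarrow> real"
  assumes "integrable lborel f"
  shows "integrable lborel (\<lambda>x. f (c + x))"
proof -
  have "integrable (distr lborel borel ((+) c)) f"
    using assms by (simp add: lborel_distr_plus)
  then show ?thesis by (rule integrable_distr[rotated]) simp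
qed

text \<open>By translation invariance the difference quotients of \<open>g\<close> have integral \<open>0\<close>.\<close>

lemma lborel_integral_pderiv_along_eq_0:
  fixes g :: "'a::euclidean_space \<Rightarrow> real"
  assumes diff: "\<And>x. g differentiable (at x)"
    and cont: "continuous_on UNIV (pderiv_along b g)"
    and S: "compact S" and out: "\<And>x. x \<notin> S \<Longrightarrow> g x = 0"
  shows "(LINT x|lborel. pderiv_along b g x) = 0"
proof -
  define h where "h n = 1 / real (Suc n)" for n
  have h: "h n > 0" "h n \<le> 1" for n by (simp_all add: h_def)
  have h0: "h \<longlonglongrightarrow> 0"
    unfolding h_def[abs_def] using LIMSEQ_inverse_real_of_nat by (simp add: inverse_eq_divide)
  have gc: "continuous_on UNIV g"
    using diff by (auto intro!: continuous_at_imp_continuous_on differentiable_imp_continuous_within)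
  have gi: "integrable lborel g"
    using S out continuous_on_subset[OF gc] by (auto intro!: integrable_lborel_vanishing_outside_compact[of S])
  have gm [measurable]: "g \<in> borel_measurable borel"
    by (rule borel_measurable_continuous_onI[OF gc])
  have pm [measurable]: "pderiv_along b g \<in> borel_measurable borel"
    by (rule borel_measurable_continuous_onI[OF cont])
  \<comment> \<open>\<open>S\<close> thickened by unit segments along \<open>b\<close>: as the step
    \<open>h n\<close> is at most 1, the difference quotients vanish outside this compact
    set.\<close>
  let ?T = "(\<lambda>p. fst p + snd p *\<^sub>R b) ` (S \<times> {-1..1::real})"
  have T: "compact ?T"
    using S by (intro compact_continuous_image compact_Times continuous_intros) auto
  have ST: "S \<subseteq> ?T" by force
  have line: "((\<lambda>s. g (x + s *\<^sub>R b)) has_real_derivative pderiv_along b g (x + t *\<^sub>R b)) (at t)" for x t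
  proof -
    have "((g \<circ> (\<lambda>s. x + s *\<^sub>R b)) has_derivative
        frechet_derivative g (at (x + t *\<^sub>R b)) \<circ> (\<lambda>s. s *\<^sub>R b)) (at t)"
      using diff by (intro diff_chain_at) (auto intro!: derivative_eq_intros simp: frechet_derivative_works)
    moreover have "frechet_derivative g (at (x + t *\<^sub>R b)) \<circ> (\<lambda>s. s *\<^sub>R b)
        = (*) (pderiv_along b g (x + t *\<^sub>R b))"
      using linear_scale[OF linear_frechet_derivative[OF diff]] by (auto simp: o_def pderiv_along_def)
    ultimately show ?thesis by (simp add: has_field_derivative_def o_def)
  qed
  \<comment> \<open>A second thickening catches the intermediate points of the mean value theorem;
    the bound \<open>C\<close> of the derivative there dominates all quotients.\<close>
  let ?U = "(\<lambda>p. fst p + snd p *\<^sub>R b) ` (?T \<times> {-1..1::real})"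
  have U: "compact ?U"
    by (intro compact_continuous_image compact_Times T continuous_intros) auto
  obtain C where C: "\<And>x. x \<in> ?U \<Longrightarrow> \<bar>pderiv_along b g x\<bar> \<le> C"
  proof -
    have "bounded (pderiv_along b g ` ?U)"
      by (intro compact_imp_bounded compact_continuous_image U continuous_on_subset[OF cont]) auto
    then show ?thesis using that unfolding bounded_real by blast
  qed
  define q where "q n x = (g (x + h n *\<^sub>R b) - g x) / h n" for n x
  have "(LINT x|lborel. q n x) = 0" for n
  proof -
    have "integrable lborel (\<lambda>x. g (x + h n *\<^sub>R b))"
      using lborel_integrable_translate[OF gi, of "h n *\<^sub>R b"] by (simp add: add.commute)
    moreover have "(LINT x|lborel. g (x + h n *\<^sub>R b)) = (LINT x|lborel. g x)"
      using lborel_integral_translate[OF gm, of "h n *\<^sub>R b"] by (simp add: add.commute)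
    ultimately show ?thesis using gi by (simp add: q_def)
  qed
  moreover have "(\<lambda>n. LINT x|lborel. q n x) \<longlonglongrightarrow> (LINT x|lborel. pderiv_along b g x)"
  proof (rule integral_dominated_convergence)
    show "integrable lborel (\<lambda>x. indicator ?T x *\<^sub>R C)"
      using T by (intro borel_integrable_compact) auto
    show "AE x in lborel. (\<lambda>n. q n x) \<longlonglongrightarrow> pderiv_along b g x"
    proof (rule AE_I2)
      fix x
      have "((\<lambda>s. (g (x + s *\<^sub>R b) - g x) / s) \<longlongrightarrow> pderiv_along b g x) (at 0)"
        using line[of x 0] by (simp add: has_field_derivative_iff)
      moreover have "filterlim h (at 0) sequentially"
        using h0 h(1) by (auto simp: filterlim_at intro!: always_eventually less_imp_neq[symmetric])
      ultimately show "(\<lambda>n. q n x) \<longlonglongrightarrow> pderiv_along b g x"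
        unfolding q_def by (rule filterlim_compose)
    qed
    show "AE x in lborel. norm (q n x) \<le> indicator ?T x *\<^sub>R C" for n
    proof (rule AE_I2)
      fix x
      show "norm (q n x) \<le> indicator ?T x *\<^sub>R C"
      proof (cases "x \<in> ?T")
        case True
        obtain t where t: "0 < t" "t < h n"
          "g (x + h n *\<^sub>R b) - g (x + 0 *\<^sub>R b) = (h n - 0) * pderiv_along b g (x + t *\<^sub>R b)"
          using MVT2[of 0 "h n" "\<lambda>s. g (x + s *\<^sub>R b)" "\<lambda>t. pderiv_along b g (x + t *\<^sub>R b)"] h line
          by blast
        have "x + t *\<^sub>R b \<in> ?U"
          using True t h(2)[of n] by (intro image_eqI[of _ _ "(x, t)"]) auto
        with C t h(1)[of n] True show ?thesis by (auto simp: q_def)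
      next
        case False
        have "x \<notin> S" using False ST by blast
        moreover have "x + h n *\<^sub>R b \<notin> S"
        proof
          assume "x + h n *\<^sub>R b \<in> S"
          then have "x \<in> ?T"
            using h[of n] by (intro image_eqI[of _ _ "(x + h n *\<^sub>R b, - h n)"]) auto
          with False show False by simp
        qed
        ultimately show ?thesis using False out by (simp add: q_def)
      qed
    qed
  qed (simp_all add: q_def)
  ultimately show ?thesis by (simp add: LIMSEQ_const_iff)
qed

lemma pderiv_along_cong:
  assumes "open A" "x \<in> A" "\<And>y. y \<in> A \<Longrightarrow> f y = g y" "g differentiable (at x)"
  shows "f differentiable (at x)" "pderiv_along b f x = pderiv_along b g x"
proof -
  have "(f has_derivative frechet_derivative g (at x)) (at x)"
    by (rule has_derivative_transform_within_open[of g _ _ _ A])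
      (use assms in \<open>auto simp: frechet_derivative_works\<close>)
  then show "f differentiable (at x)" "pderiv_along b f x = pderiv_along b g x"
    by (auto simp: differentiable_def pderiv_along_def dest: frechet_derivative_at)
qed

lemma pderiv_along_mult:
  assumes "f differentiable (at x)" "g differentiable (at x)"
  shows "pderiv_along b (\<lambda>x. f x * g x) x = f x * pderiv_along b g x + pderiv_along b f x * g x"
proof -
  have "((\<lambda>x. f x * g x) has_derivative
      (\<lambda>v. f x * frechet_derivative g (at x) v + frechet_derivative f (at x) v * g x)) (at x)"
    using assms by (intro has_derivative_mult) (simp_all add: frechet_derivative_works)
  from frechet_derivative_at[OF this] show ?thesis
    by (simp add: pderiv_along_def fun_eq_iff)
qed

lemma pderiv_along_vanishing_outside_compact:
  assumes "compact S" "\<And>y. y \<notin> S \<Longrightarrow> f y = 0" "x \<notin> S"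
  shows "f differentiable (at x)" "pderiv_along b f x = (0::real)"
proof -
  have S: "open (- S)" using assms(1) by (simp add: compact_imp_closed open_Compl)
  have "pderiv_along b (\<lambda>x. 0::real) x = 0" by (simp add: pderiv_along_def)
  then show "f differentiable (at x)" "pderiv_along b f x = 0"
    using pderiv_along_cong[OF S, of x f "\<lambda>x. 0"] assms by auto
qed

text \<open>The product \<open>f * \<phi>\<close>, extended by zero, is differentiable with
  continuous derivative along \<open>b\<close>: \<open>\<Omega>\<close> and \<open>- S\<close> are
  open and cover the space, the product rule holds on the first, and the extension vanishes on the
  second. Hence that derivative integrates to 0.\<close>

lemma lborel_integral_by_parts:
  fixes f \<phi> :: "'a::euclidean_space \<Rightarrow> real"
  assumes \<Omega>: "open \<Omega>" and S: "compact S" "S \<subseteq> \<Omega>"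
    and f: "\<And>x. x \<in> \<Omega> \<Longrightarrow> f differentiable (at x)" "continuous_on \<Omega> (pderiv_along b f)"
    and \<phi>: "\<And>x. \<phi> differentiable (at x)" "continuous_on UNIV (pderiv_along b \<phi>)"
    and out: "\<And>x. x \<notin> S \<Longrightarrow> \<phi> x = 0"
  shows "(LINT x|lborel. indicator \<Omega> x * (f x * pderiv_along b \<phi> x))
    = - (LINT x|lborel. indicator \<Omega> x * (pderiv_along b f x * \<phi> x))"
proof -
  define g where "g x = (if x \<in> \<Omega> then f x * \<phi> x else 0)" for x
  have fc: "continuous_on \<Omega> f"
    using f(1) by (auto intro!: continuous_at_imp_continuous_on differentiable_imp_continuous_within)
  have \<phi>c: "continuous_on UNIV \<phi>"
    using \<phi>(1) by (auto intro!: continuous_at_imp_continuous_on differentiable_imp_continuous_within)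
  have \<phi>'out: "pderiv_along b \<phi> x = 0" if "x \<notin> S" for x
    by (rule pderiv_along_vanishing_outside_compact[OF S(1) out that])
  have gout: "g x = 0" if "x \<notin> S" for x
    using out[OF that] by (simp add: g_def)
  have in\<Omega>: "g differentiable (at x)"
      "pderiv_along b g x = f x * pderiv_along b \<phi> x + pderiv_along b f x * \<phi> x" if "x \<in> \<Omega>" for x
    using pderiv_along_cong[OF \<Omega> that, of g "\<lambda>x. f x * \<phi> x"] that f(1) \<phi>(1)
    by (auto simp: g_def pderiv_along_mult)
  have outS: "g differentiable (at x)" "pderiv_along b g x = 0" if "x \<notin> S" for x
    using pderiv_along_vanishing_outside_compact[OF S(1) gout that] by auto
  have gd: "g differentiable (at x)" for x
    using in\<Omega>(1) outS(1) S(2) by blast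
  have gc: "continuous_on UNIV (pderiv_along b g)"
  proof -
    have "continuous_on \<Omega> (\<lambda>x. f x * pderiv_along b \<phi> x + pderiv_along b f x * \<phi> x)"
      by (intro continuous_intros fc f(2) continuous_on_subset[OF \<phi>c] continuous_on_subset[OF \<phi>(2)]) auto
    then have "continuous_on \<Omega> (pderiv_along b g)"
      using in\<Omega>(2) by (simp cong: continuous_on_cong)
    moreover have "continuous_on (- S) (pderiv_along b g)"
      by (rule continuous_on_eq[OF continuous_on_const[of _ 0]]) (simp add: outS)
    ultimately have "continuous_on (\<Omega> \<union> - S) (pderiv_along b g)"
      using \<Omega> S(1) by (intro continuous_on_open_Un) (auto simp: compact_imp_closed open_Compl)
    moreover have "\<Omega> \<union> - S = UNIV" using S(2) by blast
    ultimately show ?thesis by simp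
  qed
  have i1: "integrable lborel (\<lambda>x. indicator \<Omega> x * (f x * pderiv_along b \<phi> x))"
  proof (rule integrable_lborel_vanishing_outside_compact[OF S(1)])
    have "continuous_on S (\<lambda>x. f x * pderiv_along b \<phi> x)"
      by (intro continuous_intros continuous_on_subset[OF fc] continuous_on_subset[OF \<phi>(2)]) (use S in auto)
    then show "continuous_on S (\<lambda>x. indicator \<Omega> x * (f x * pderiv_along b \<phi> x))"
      by (rule continuous_on_eq) (use S in auto)
  qed (simp add: \<phi>'out)
  have i2: "integrable lborel (\<lambda>x. indicator \<Omega> x * (pderiv_along b f x * \<phi> x))"
  proof (rule integrable_lborel_vanishing_outside_compact[OF S(1)])
    have "continuous_on S (\<lambda>x. pderiv_along b f x * \<phi> x)"
      by (intro continuous_intros continuous_on_subset[OF f(2)] continuous_on_subset[OF \<phi>c]) (use S in auto)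
    then show "continuous_on S (\<lambda>x. indicator \<Omega> x * (pderiv_along b f x * \<phi> x))"
      by (rule continuous_on_eq) (use S in auto)
  qed (simp add: out)
  have "pderiv_along b g x = indicator \<Omega> x * (f x * pderiv_along b \<phi> x)
      + indicator \<Omega> x * (pderiv_along b f x * \<phi> x)" for x
    using in\<Omega>(2)[of x] outS(2)[of x] S(2) by (cases "x \<in> \<Omega>") auto
  then have "(LINT x|lborel. indicator \<Omega> x * (f x * pderiv_along b \<phi> x))
      + (LINT x|lborel. indicator \<Omega> x * (pderiv_along b f x * \<phi> x)) = (LINT x|lborel. pderiv_along b g x)"
    using i1 i2 by simp
  also have "\<dots> = 0"
    by (rule lborel_integral_pderiv_along_eq_0[OF gd gc S(1) gout])
  finally show ?thesis by simp
qed

text \<open>The outermost derivative of \<open>\<phi>\<close> moves over first and thus becomes the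
  innermost one on \<open>f\<close>, whence \<open>rev\<close>.\<close>

lemma lborel_integral_by_parts_iter:
  fixes f \<phi> :: "'a::euclidean_space \<Rightarrow> real"
  assumes "open \<Omega>" "compact S" "S \<subseteq> \<Omega>"
    and \<phi>: "\<And>k. Ck_on k UNIV \<phi>" "\<And>x. x \<notin> S \<Longrightarrow> \<phi> x = 0"
  shows "set bs \<subseteq> Basis \<Longrightarrow> Ck_on (length bs) \<Omega> f \<Longrightarrow>
    (LINT x|lborel. indicator \<Omega> x * (f x * iter_pderiv bs \<phi> x))
    = (-1) ^ length bs * (LINT x|lborel. indicator \<Omega> x * (iter_pderiv (rev bs) f x * \<phi> x))"
proof (induction bs arbitrary: f)
  case (Cons b bs)
  have out: "iter_pderiv as \<phi> x = 0" if "x \<notin> S" for x as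
    using that
  proof (induction as arbitrary: x)
    case (Cons a as)
    then show ?case
      using pderiv_along_vanishing_outside_compact(2)[OF assms(2), of "iter_pderiv as \<phi>" x a] by simp
  qed (simp add: \<phi>)
  have C: "Ck_on 1 UNIV (iter_pderiv bs \<phi>)"
    using \<phi>(1) Cons.prems by (intro Ck_on_iter_pderiv) auto
  have f: "Ck_on (length bs) \<Omega> (pderiv_along b f)" "\<And>x. x \<in> \<Omega> \<Longrightarrow> f differentiable (at x)"
    using Cons.prems by auto
  have "(LINT x|lborel. indicator \<Omega> x * (f x * pderiv_along b (iter_pderiv bs \<phi>) x))
      = - (LINT x|lborel. indicator \<Omega> x * (pderiv_along b f x * iter_pderiv bs \<phi> x))"
    using C Cons.prems
    by (intro lborel_integral_by_parts[OF assms(1-3)] f Ck_on_imp_continuous_on[OF f(1)] out) auto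
  with Cons f show ?case by (simp add: iter_pderiv_append)
qed simp

section \<open>From essential bounds to bounds at every point\<close>

lemma set_lebesgue_integral_eq_lborel:
  fixes f :: "'a::euclidean_space \<Rightarrow> real"
  assumes "(\<lambda>x. indicator A x * f x) \<in> borel_measurable borel"
  shows "(LINT x:A|lebesgue. f x) = (LINT x|lborel. indicator A x * f x)"
  using assms by (simp add: set_lebesgue_integral_def integral_completion)

lemma set_lebesgue_integral_eq_lebesgue_on:
  fixes f :: "'a::euclidean_space \<Rightarrow> real"
  assumes "A \<in> sets lebesgue"
  shows "(LINT x:A|lebesgue. f x) = (LINT x|lebesgue_on A. f x)"
  using assms by (simp add: set_lebesgue_integral_def integral_restrict_space)

lemma borel_measurable_indicator_times_continuous_on:
  fixes f :: "'a::euclidean_space \<Rightarrow> real"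
  assumes "open A" "continuous_on A f"
  shows "(\<lambda>x. indicator A x * f x) \<in> borel_measurable borel"
  using borel_measurable_continuous_on_indicator[of A f] assms by simp

lemma Linfty_AE_bound:
  assumes "g \<in> Linfty \<Omega>"
  shows "AE x in lebesgue_on \<Omega>. \<bar>g x\<bar> \<le> enn2real (Linfty_norm \<Omega> g)"
proof -
  have fin: "Linfty_norm \<Omega> g < top" using assms by (simp add: Linfty_def)
  have "AE x in lebesgue_on \<Omega>. ennreal \<bar>g x\<bar> \<le> Linfty_norm \<Omega> g"
    unfolding Linfty_norm_def by (rule esssup_AE)
  then show ?thesis
  proof eventually_elim
    case (elim x)
    then show ?case using fin enn2real_mono[OF elim] by simp
  qed
qed

text \<open>If |f| exceeded the essential bound \<open>M\<close> of \<open>g\<close> at one point,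
  then by continuity \<open>s * f > M\<close> on a small ball. Testing with the bump of that ball
  gives a nonnegative function (s f - M) \<phi> with integral at most 0 that is positive on the
  ball, which would then be a null set. Serves both for \<open>g\<close> a weak derivative and for
  \<open>g = f\<close>.\<close>

lemma abs_le_Linfty_norm_of_weak_eq:
  fixes f g :: "'a::euclidean_space \<Rightarrow> real"
  assumes \<Omega>: "open \<Omega>" and f: "continuous_on \<Omega> f" and g: "g \<in> Linfty \<Omega>"
    and eq: "\<And>\<phi>. test_function \<Omega> \<phi> \<Longrightarrow>
      (LINT x|lborel. indicator \<Omega> x * (f x * \<phi> x)) = (LINT x:\<Omega>|lebesgue. g x * \<phi> x)"
    and x: "x \<in> \<Omega>"
  shows "\<bar>f x\<bar> \<le> enn2real (Linfty_norm \<Omega> g)"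
proof (rule ccontr)
  define M where "M = enn2real (Linfty_norm \<Omega> g)"
  \<comment> \<open>The sign treats large positive and large negative values of \<open>f x\<close>
    at once.\<close>
  define s where "s = sgn (f x)"
  assume "\<not> \<bar>f x\<bar> \<le> enn2real (Linfty_norm \<Omega> g)"
  then have Mx: "M < s * f x" and M0: "M \<ge> 0"
    by (auto simp: M_def s_def abs_sgn mult.commute)
  have s1: "\<bar>s\<bar> = 1" using Mx M0 by (auto simp: s_def abs_sgn_eq)
  have "open (\<Omega> \<inter> (\<lambda>y. s * f y) -` {M<..})"
    by (intro continuous_open_preimage continuous_intros f \<Omega> open_greaterThan)
  then obtain r where r: "r > 0" "cball x r \<subseteq> \<Omega> \<inter> (\<lambda>y. s * f y) -` {M<..}"
    using x Mx unfolding open_contains_cball by blast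
  let ?\<phi> = "bump x r"
  have \<phi>0: "?\<phi> y = 0" if "y \<notin> cball x r" for y
    using bump_neq_0_iff[OF r(1), of x y] that by auto
  have \<phi>c: "continuous_on A ?\<phi>" for A
    using Ck_on_bump[of 0 x r] continuous_on_subset by auto
  have [measurable]: "?\<phi> \<in> borel_measurable borel"
    by (rule borel_measurable_continuous_onI[OF \<phi>c])
  have \<Omega>L: "\<Omega> \<in> sets lebesgue" using \<Omega> by (simp add: lborelD)
  have [measurable]: "\<Omega> \<in> sets borel" using \<Omega> by simp
  have int1: "integrable lborel (\<lambda>y. indicator \<Omega> y * (f y * ?\<phi> y))"
  proof (rule integrable_lborel_vanishing_outside_compact[of "cball x r"])
    have "continuous_on (cball x r) (\<lambda>y. f y * ?\<phi> y)"
      by (intro continuous_intros continuous_on_subset[OF f] \<phi>c) (use r in auto)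
    then show "continuous_on (cball x r) (\<lambda>y. indicator \<Omega> y * (f y * ?\<phi> y))"
      by (rule continuous_on_eq) (use r in auto)
  qed (simp_all add: \<phi>0 del: mem_cball)
  have int2: "integrable lborel (\<lambda>y. indicator \<Omega> y * ?\<phi> y)"
  proof (rule integrable_lborel_vanishing_outside_compact[of "cball x r"])
    show "continuous_on (cball x r) (\<lambda>y. indicator \<Omega> y * ?\<phi> y)"
      by (rule continuous_on_eq[OF \<phi>c]) (use r in auto)
  qed (simp_all add: \<phi>0 del: mem_cball)
  have int2L: "integrable (lebesgue_on \<Omega>) ?\<phi>"
    using int2 \<Omega>L by (subst integrable_restrict_space) (auto simp: integrable_completion)
  have AEb: "AE y in lebesgue_on \<Omega>. \<bar>g y\<bar> \<le> M"
    unfolding M_def by (rule Linfty_AE_bound[OF g])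
  have gm: "g \<in> borel_measurable (lebesgue_on \<Omega>)" using g by (simp add: Linfty_def)
  have \<phi>m: "?\<phi> \<in> borel_measurable (lebesgue_on \<Omega>)"
    using int2L by auto
  have AEs: "AE y in lebesgue_on \<Omega>. \<bar>g y * ?\<phi> y\<bar> \<le> M * ?\<phi> y"
    using AEb by eventually_elim (auto simp: abs_mult bump_nonneg intro: mult_right_mono)
  have int3: "integrable (lebesgue_on \<Omega>) (\<lambda>y. g y * ?\<phi> y)"
    by (rule Bochner_Integration.integrable_bound[where f="\<lambda>y. M * ?\<phi> y"])
      (use AEs int2L gm \<phi>m in \<open>auto simp: bump_nonneg M0 abs_mult\<close>)
  have "s * (LINT y|lborel. indicator \<Omega> y * (f y * ?\<phi> y)) = s * (LINT y|lebesgue_on \<Omega>. g y * ?\<phi> y)"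
    using eq[OF test_function_bump[OF r(1), of x \<Omega>]] r(2)
    by (simp add: set_lebesgue_integral_eq_lebesgue_on[OF \<Omega>L])
  also have "\<dots> = (LINT y|lebesgue_on \<Omega>. s * (g y * ?\<phi> y))" by simp
  also have "\<dots> \<le> (LINT y|lebesgue_on \<Omega>. M * ?\<phi> y)"
  proof (rule integral_mono_AE)
    show "AE y in lebesgue_on \<Omega>. s * (g y * ?\<phi> y) \<le> M * ?\<phi> y"
      using AEs
    proof eventually_elim
      case (elim y)
      have "s * (g y * ?\<phi> y) \<le> \<bar>s\<bar> * \<bar>g y * ?\<phi> y\<bar>" by (metis abs_ge_self abs_mult)
      with elim s1 show ?case by simp
    qed
  qed (use int3 int2L in auto)
  also have "\<dots> = M * (LINT y|lborel. indicator \<Omega> y * ?\<phi> y)"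
    using set_lebesgue_integral_eq_lebesgue_on[OF \<Omega>L, of ?\<phi>]
    by (subst (asm) set_lebesgue_integral_eq_lborel) auto
  finally have le: "(LINT y|lborel. indicator \<Omega> y * ((s * f y - M) * ?\<phi> y)) \<le> 0"
    using int1 int2 by (simp add: algebra_simps)
  have int4: "integrable lborel (\<lambda>y. indicator \<Omega> y * ((s * f y - M) * ?\<phi> y))"
    using Bochner_Integration.integrable_diff[OF integrable_mult_right[OF int1, of s] integrable_mult_right[OF int2, of M]]
    by (simp add: algebra_simps)
  have nn: "0 \<le> indicator \<Omega> y * ((s * f y - M) * ?\<phi> y)" for y
  proof (cases "y \<in> cball x r")
    case True
    with r(2) have "y \<in> \<Omega>" "M < s * f y" by blast+
    then show ?thesis using bump_nonneg[of x r y] by simp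
  qed (simp add: \<phi>0)
  have "(LINT y|lborel. indicator \<Omega> y * ((s * f y - M) * ?\<phi> y)) = 0"
    using le nn by (intro antisym integral_nonneg_AE) auto
  then have "AE y in lborel. indicator \<Omega> y * ((s * f y - M) * ?\<phi> y) = 0"
    using integral_nonneg_eq_0_iff_AE[OF int4] nn by simp
  then have "AE y in lborel. y \<notin> ball x r"
  proof eventually_elim
    case (elim y)
    show ?case
    proof
      assume y: "y \<in> ball x r"
      then have "y \<in> cball x r" by simp
      with r(2) have "y \<in> \<Omega>" "M < s * f y" by blast+
      with elim y bump_neq_0_iff[OF r(1), of x y] show False by simp
    qed
  qed
  then have "ball x r \<in> null_sets lborel"
    by (subst AE_iff_null_sets) auto
  then have "negligible (ball x r)"
    by (simp add: negligible_iff_null_sets null_sets_completion_iff)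
  with r(1) show False
    using open_not_negligible[of "ball x r"] by simp
qed

lemma W_infty_pderivs_bounded:
  fixes u :: "'a::euclidean_space \<Rightarrow> real"
  assumes \<Omega>: "open \<Omega>" and C: "Ck_on n \<Omega> u" and W: "u \<in> W_infty n \<Omega>"
  obtains M where "M \<ge> 0"
    "\<And>bs y. set bs \<subseteq> Basis \<Longrightarrow> length bs \<le> n \<Longrightarrow> y \<in> \<Omega> \<Longrightarrow> \<bar>iter_pderiv bs u y\<bar> \<le> M"
proof -
  let ?B = "{bs::'a list. set bs \<subseteq> Basis \<and> length bs \<le> n}"
  have "\<exists>M\<ge>0. \<forall>y\<in>\<Omega>. \<bar>iter_pderiv bs u y\<bar> \<le> M" if bs: "bs \<in> ?B" for bs
  proof -
    \<comment> \<open>The reversed list compensates for the reversal in the iterated integration by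
      parts.\<close>
    obtain g where g: "g \<in> Linfty \<Omega>" "weak_pderiv \<Omega> (rev bs) u g"
      using W bs by (auto simp: W_infty_def dest!: spec[of _ "rev bs"])
    have cont: "continuous_on \<Omega> (iter_pderiv bs u)"
      using continuous_on_iter_pderiv[OF C] bs by auto
    have "(LINT x|lborel. indicator \<Omega> x * (iter_pderiv bs u x * \<phi> x)) = (LINT x:\<Omega>|lebesgue. g x * \<phi> x)"
      if \<phi>: "test_function \<Omega> \<phi>" for \<phi>
    proof -
      have \<phi>C: "\<And>k. Ck_on k UNIV \<phi>" and S: "compact (supp_on UNIV \<phi>)" "supp_on UNIV \<phi> \<subseteq> \<Omega>"
        using \<phi> by (auto simp: test_function_def)
      have out: "\<phi> x = 0" if "x \<notin> supp_on UNIV \<phi>" for x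
        using that closure_subset[of "{x. \<phi> x \<noteq> 0}"] by (auto simp: supp_on_def)
      have "continuous_on UNIV (iter_pderiv (rev bs) \<phi>)"
        using \<phi>C[of "length bs"] bs by (intro continuous_on_iter_pderiv) auto
      then have "(\<lambda>x. indicator \<Omega> x * (u x * iter_pderiv (rev bs) \<phi> x)) \<in> borel_measurable borel"
        by (intro borel_measurable_indicator_times_continuous_on \<Omega> continuous_intros
            Ck_on_imp_continuous_on[OF C]) (auto intro: continuous_on_subset)
      note m = set_lebesgue_integral_eq_lborel[OF this]
      have "(-1) ^ length bs * (LINT x:\<Omega>|lebesgue. g x * \<phi> x)
          = (LINT x|lborel. indicator \<Omega> x * (u x * iter_pderiv (rev bs) \<phi> x))"
        using g(2) \<phi> unfolding weak_pderiv_def m[symmetric] by simp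
      also have "\<dots> = (-1) ^ length bs * (LINT x|lborel. indicator \<Omega> x * (iter_pderiv bs u x * \<phi> x))"
        using lborel_integral_by_parts_iter[OF \<Omega> S \<phi>C out, of "rev bs" u] bs Ck_on_antimono[OF C]
        by simp
      finally show ?thesis by simp
    qed
    from abs_le_Linfty_norm_of_weak_eq[OF \<Omega> cont g(1) this]
    show ?thesis by (intro exI[of _ "enn2real (Linfty_norm \<Omega> g)"]) auto
  qed
  then have "\<forall>bs\<in>?B. \<exists>M. M \<ge> 0 \<and> (\<forall>y\<in>\<Omega>. \<bar>iter_pderiv bs u y\<bar> \<le> M)" by blast
  then obtain M where "\<forall>bs\<in>?B. M bs \<ge> 0 \<and> (\<forall>y\<in>\<Omega>. \<bar>iter_pderiv bs u y\<bar> \<le> M bs)"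
    by (rule bchoice[THEN exE])
  then have M: "\<And>bs. bs \<in> ?B \<Longrightarrow> M bs \<ge> 0"
    "\<And>bs y. bs \<in> ?B \<Longrightarrow> y \<in> \<Omega> \<Longrightarrow> \<bar>iter_pderiv bs u y\<bar> \<le> M bs" by blast+
  have fin: "finite ?B" by (rule finite_lists_length_le) simp
  show ?thesis
  \<comment> \<open>There are finitely many lists of length at most \<open>n\<close> over the basis;
    the sum of their nonnegative bounds dominates each of them.\<close>
  proof (rule that[of "\<Sum>bs\<in>?B. M bs"])
    show "0 \<le> (\<Sum>bs\<in>?B. M bs)" by (intro sum_nonneg M)
    show "\<bar>iter_pderiv bs u y\<bar> \<le> (\<Sum>bs\<in>?B. M bs)"
      if "set bs \<subseteq> Basis" "length bs \<le> n" "y \<in> \<Omega>" for bs y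
      using M(2)[of bs y] member_le_sum[OF _ _ fin, of bs M] M(1) that by fastforce
  qed
qed

section \<open>Moments of the kernel\<close>

text \<open>Dyadic decomposition: on the shell R/2^(k+1) \<le> |z| < R/2^k the function is at most
  \<open>w k\<close>. Enlarging each shell to the full ball of radius R/2^k costs nothing essential,
  and the weighted volumes decay geometrically.\<close>

lemma integrable_inverse_norm_ball:
  assumes d: "DIM('a::euclidean_space) \<ge> 2"
  shows "integrable lborel (\<lambda>z::'a. indicator (ball 0 R) z / norm z)"
proof (cases "R > 0")
  case True
  let ?c = "unit_ball_vol (real DIM('a))"
  define w where "w k = 2 ^ (k + 1) / R" for k :: nat
  have [measurable]: "ball (0::'a) s \<in> sets borel" for s by simp
  have w0: "w k \<ge> 0" for k using True by (simp add: w_def)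
  have le: "ennreal (indicator (ball 0 R) z / norm z)
      \<le> (\<Sum>k. ennreal (w k) * indicator (ball 0 (R / 2 ^ k)) z)" for z :: 'a
  proof (cases "z \<in> ball 0 R \<and> z \<noteq> 0")
    case zR: True
    have "(\<lambda>k. R * (1 / 2) ^ k) \<longlonglongrightarrow> R * 0"
      by (intro tendsto_mult tendsto_const LIMSEQ_power_zero) auto
    then have "\<forall>\<^sub>F k in sequentially. R * (1 / 2) ^ k < norm z"
      by (rule order_tendstoD) (use zR in auto)
    then have "\<exists>k. R / 2 ^ k \<le> norm z"
      by (auto simp: eventually_sequentially power_one_over field_simps intro: less_imp_le)
    \<comment> \<open>The least such \<open>j\<close> is positive since |z| < R, and k = j - 1 names
      the shell of \<open>z\<close>.\<close>
    then obtain j where j: "R / 2 ^ j \<le> norm z" "\<And>i. i < j \<Longrightarrow> \<not> R / 2 ^ i \<le> norm z"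
      using LeastI_ex[of "\<lambda>k. R / 2 ^ k \<le> norm z"] not_less_Least[of _ "\<lambda>k. R / 2 ^ k \<le> norm z"]
      by blast
    have "j \<noteq> 0" using j(1) zR by (cases j) auto
    then obtain k where k: "j = Suc k" by (cases j) auto
    have zk: "z \<in> ball 0 (R / 2 ^ k)" using j(2)[of k] k by auto
    have "1 / norm z \<le> w k"
      using j(1) k zR True by (simp add: w_def field_simps)
    then have "ennreal (indicator (ball 0 R) z / norm z) \<le> (\<Sum>k\<in>{k}. ennreal (w k) * indicator (ball 0 (R / 2 ^ k)) z)"
      using zR zk by (simp add: ennreal_leI)
    also have "\<dots> \<le> (\<Sum>k. ennreal (w k) * indicator (ball 0 (R / 2 ^ k)) z)"
      by (rule sum_le_suminf) auto
    finally show ?thesis .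
  next
    case False
    then have "indicator (ball 0 R) z / norm z = 0" by (auto simp: indicator_def)
    then show ?thesis by (simp only:) simp
  qed
  have bd: "w k * (?c * (R / 2 ^ k) ^ DIM('a)) \<le> 2 * ?c * R ^ DIM('a) / R * (1 / 2) ^ k" for k
  proof -
    \<comment> \<open>Here d \<ge> 2 enters: one factor 2^k absorbs the growth of
      \<open>w k\<close>, the other leaves the geometric decay.\<close>
    have "(2::real) ^ k * 2 ^ k \<le> (2 ^ k) ^ DIM('a)"
      using power_increasing[OF d, of "2 ^ k :: real"] by (simp add: power2_eq_square)
    then have "(R / 2 ^ k) ^ DIM('a) \<le> R ^ DIM('a) / (2 ^ k * 2 ^ k)"
      using True by (simp add: power_divide frac_le)
    then have "w k * (?c * (R / 2 ^ k) ^ DIM('a)) \<le> w k * (?c * (R ^ DIM('a) / (2 ^ k * 2 ^ k)))"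
      using w0 by (intro mult_left_mono) auto
    also have "\<dots> = 2 * ?c * R ^ DIM('a) / R * (1 / 2) ^ k"
      using True by (simp add: w_def power_one_over field_simps)
    finally show ?thesis .
  qed
  have summ: "summable (\<lambda>k. w k * (?c * (R / 2 ^ k) ^ DIM('a)))"
  proof (rule summable_comparison_test')
    show "summable (\<lambda>k. 2 * ?c * R ^ DIM('a) / R * (1 / 2) ^ k)"
      by (intro summable_mult summable_geometric) auto
    show "norm (w k * (?c * (R / 2 ^ k) ^ DIM('a))) \<le> 2 * ?c * R ^ DIM('a) / R * (1 / 2) ^ k" for k
      using bd[of k] w0[of k] True by (simp add: abs_mult)
  qed
  have "(\<integral>\<^sup>+z. ennreal (indicator (ball 0 R) z / norm z) \<partial>(lborel :: 'a measure))
      \<le> (\<integral>\<^sup>+z. (\<Sum>k. ennreal (w k) * indicator (ball 0 (R / 2 ^ k)) z) \<partial>(lborel :: 'a measure))"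
    by (intro nn_integral_mono le)
  also have "\<dots> = (\<Sum>k. ennreal (w k) * emeasure lborel (ball (0::'a) (R / 2 ^ k)))"
    by (subst nn_integral_suminf) (measurable, simp add: nn_integral_cmult_indicator)
  also have "\<dots> = (\<Sum>k. ennreal (w k * (?c * (R / 2 ^ k) ^ DIM('a))))"
    using True by (subst emeasure_ball) (auto simp: ennreal_mult w0)
  also have "\<dots> < \<infinity>"
    using True w0 by (subst suminf_ennreal2[OF _ summ]) auto
  finally show ?thesis
  proof (intro integrableI_bounded)
    show "(\<lambda>z::'a. indicator (ball 0 R) z / norm z) \<in> borel_measurable lborel"
      by (intro borel_measurable_divide borel_measurable_indicator) auto
  qed simp
next
  case False
  then have "ball (0::'a) R = {}" by (simp add: not_less)
  then show ?thesis by (simp only:) simp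
qed

section \<open>Sign changes and permutations of coordinates preserve Lebesgue measure\<close>

lemma lborel_distr_sign_change:
  fixes c :: "'a::euclidean_space \<Rightarrow> real"
  assumes "\<And>j. j \<in> Basis \<Longrightarrow> \<bar>c j\<bar> = 1"
  shows "distr lborel borel (\<lambda>x. \<Sum>j\<in>Basis. (c j * (x \<bullet> j)) *\<^sub>R j) = (lborel :: 'a measure)"
proof -
  have "c j \<noteq> 0" if "j \<in> Basis" for j using assms[OF that] by auto
  from lborel_affine_euclidean[of c 0, OF this] assms show ?thesis
    by (simp add: density_1)
qed

text \<open>Lebesgue measure is determined by its values on boxes; the preimage of a box is a box
  with permuted side lengths, whose product is unchanged.\<close>

lemma lborel_distr_permute_Basis:
  assumes "p permutes (Basis :: 'a::euclidean_space set)"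
  shows "distr lborel borel (\<lambda>x. \<Sum>j\<in>Basis. (x \<bullet> p j) *\<^sub>R j) = (lborel :: 'a measure)"
proof (rule lborel_eqI[symmetric])
  let ?T = "\<lambda>x. \<Sum>j\<in>Basis. (x \<bullet> p j) *\<^sub>R (j::'a)"
  let ?q = "inv p"
  let ?S = "\<lambda>x. \<Sum>j\<in>Basis. (x \<bullet> ?q j) *\<^sub>R (j::'a)"
  have q: "?q permutes Basis" by (rule permutes_inv[OF assms])
  have pB: "p j \<in> Basis \<longleftrightarrow> j \<in> Basis" "?q j \<in> Basis \<longleftrightarrow> j \<in> Basis" for j
    using permutes_in_image[OF assms] permutes_in_image[OF q] by auto
  have pq: "p (?q j) = j" "?q (p j) = j" for j
    using permutes_inverses[OF assms] by auto
  have [measurable]: "?T \<in> borel_measurable borel"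
    by (intro borel_measurable_continuous_onI continuous_intros)
  fix l u :: 'a
  assume le: "\<And>b. b \<in> Basis \<Longrightarrow> l \<bullet> b \<le> u \<bullet> b"
  have "?T -` box l u = box (?S l) (?S u)"
  proof (intro set_eqI iffI)
    fix x assume "x \<in> ?T -` box l u"
    then have "l \<bullet> i < x \<bullet> p i \<and> x \<bullet> p i < u \<bullet> i" if "i \<in> Basis" for i
      using that by (simp add: mem_box)
    from this[of "?q i" for i] show "x \<in> box (?S l) (?S u)" by (simp add: mem_box pB pq)
  next
    fix x assume "x \<in> box (?S l) (?S u)"
    then have "l \<bullet> ?q i < x \<bullet> i \<and> x \<bullet> i < u \<bullet> ?q i" if "i \<in> Basis" for i
      using that by (simp add: mem_box)
    from this[of "p i" for i] show "x \<in> ?T -` box l u" by (simp add: mem_box pB pq)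
  qed
  then have "emeasure (distr lborel borel ?T) (box l u) = emeasure lborel (box (?S l) (?S u))"
    by (simp add: emeasure_distr)
  also have "\<dots> = (\<Prod>b\<in>Basis. (u - l) \<bullet> ?q b)"
    using le pB by (subst emeasure_lborel_box) (auto simp: inner_diff_left)
  also have "(\<Prod>b\<in>Basis. (u - l) \<bullet> ?q b) = (\<Prod>b\<in>Basis. (u - l) \<bullet> b)"
    using prod.permute[OF q, of "\<lambda>b. (u - l) \<bullet> b"] by (simp add: o_def)
  finally show "emeasure (distr lborel borel ?T) (box l u) = (\<Prod>b\<in>Basis. (u - l) \<bullet> b)" .
qed simp

lemma lborel_integral_sign_change:
  fixes f :: "'a::euclidean_space \<Rightarrow> real"
  assumes "f \<in> borel_measurable borel" "\<And>j. j \<in> Basis \<Longrightarrow> \<bar>c j\<bar> = 1"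
  shows "(LINT x|lborel. f (\<Sum>j\<in>Basis. (c j * (x \<bullet> j)) *\<^sub>R j)) = (LINT x|lborel. f x)"
proof -
  have "(LINT x|lborel. f x) = (LINT x|distr lborel borel (\<lambda>x. \<Sum>j\<in>Basis. (c j * (x \<bullet> j)) *\<^sub>R j). f x)"
    by (simp add: lborel_distr_sign_change assms)
  also have "\<dots> = (LINT x|lborel. f (\<Sum>j\<in>Basis. (c j * (x \<bullet> j)) *\<^sub>R j))"
    using assms by (subst integral_distr) (auto intro!: borel_measurable_continuous_onI continuous_intros)
  finally show ?thesis by simp
qed

lemma lborel_integral_permute_Basis:
  fixes f :: "'a::euclidean_space \<Rightarrow> real"
  assumes "f \<in> borel_measurable borel" "p permutes Basis"
  shows "(LINT x|lborel. f (\<Sum>j\<in>Basis. (x \<bullet> p j) *\<^sub>R j)) = (LINT x|lborel. f x)"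
proof -
  have "(LINT x|lborel. f x) = (LINT x|distr lborel borel (\<lambda>x. \<Sum>j\<in>Basis. (x \<bullet> p j) *\<^sub>R j). f x)"
    by (simp add: lborel_distr_permute_Basis assms)
  also have "\<dots> = (LINT x|lborel. f (\<Sum>j\<in>Basis. (x \<bullet> p j) *\<^sub>R j))"
    using assms by (subst integral_distr) (auto intro!: borel_measurable_continuous_onI continuous_intros)
  finally show ?thesis by simp
qed

lemma lborel_integral_uminus:
  fixes f :: "'a::euclidean_space \<Rightarrow> real"
  assumes "f \<in> borel_measurable borel"
  shows "(LINT x|lborel. f (- x)) = (LINT x|lborel. f x)"
  using lborel_integral_sign_change[OF assms, of "\<lambda>_. -1"]
  by (simp add: sum_negf euclidean_representation)

section \<open>Radial kernels and their second moments\<close>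

definition kernel_mu :: "(real \<Rightarrow> real) \<Rightarrow> 'a::euclidean_space \<Rightarrow> real" where
  "kernel_mu r z = r (norm z) / (norm z)\<^sup>2"

lemma kernel_mu_minus [simp]: "kernel_mu r (- z) = kernel_mu r z"
  by (simp add: kernel_mu_def)

lemma kernel_profile_nonneg: "kernel_profile T \<delta> r \<Longrightarrow> r (norm z) \<ge> 0"
  by (simp add: kernel_profile_def)

lemma kernel_mu_nonneg: "kernel_profile T \<delta> r \<Longrightarrow> kernel_mu r z \<ge> 0"
  by (simp add: kernel_mu_def kernel_profile_nonneg)

text \<open>On the diagonal both sides are 0: the left one through the vector x - y, the right one
  because division by zero yields 0.\<close>

lemma power2_norm_kernel_alpha:
  assumes "kernel_profile T \<delta> r"
  shows "(norm (kernel_alpha r x y))\<^sup>2 = kernel_mu r (x - y)"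
proof (cases "x = y")
  case False
  then have "norm (x - y) > 0" by simp
  with kernel_profile_nonneg[OF assms, of "x - y"] show ?thesis
    by (simp add: kernel_alpha_def kernel_mu_def power_mult_distrib power_divide divide_simps power2_eq_square)
qed (simp add: kernel_alpha_def kernel_mu_def)

lemma kernel_profile_eq_0:
  assumes "kernel_profile T \<delta> r" "norm z \<ge> \<delta>"
  shows "r (norm z) = 0"
proof (rule ccontr)
  assume "r (norm z) \<noteq> 0"
  then have "norm z \<in> closure {t. t \<ge> 0 \<and> r t \<noteq> 0}"
    using closure_subset by fastforce
  with assms show False unfolding kernel_profile_def by fastforce
qed

lemma kernel_mu_eq_0: "kernel_profile T \<delta> r \<Longrightarrow> norm z \<ge> \<delta> \<Longrightarrow> kernel_mu r z = 0"
  by (simp add: kernel_mu_def kernel_profile_eq_0)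

lemma kernel_profile_continuous_on:
  assumes "kernel_profile T \<delta> r"
  shows "continuous_on {0..} r"
proof -
  obtain D where D: "\<forall>t\<ge>0. D 0 t = r t"
    "\<forall>k. \<forall>t\<ge>0. (D k has_real_derivative D (Suc k) t) (at t within {0..})"
    using assms by (auto simp: kernel_profile_def smooth_halfline_def)
  have "continuous_on {0..} (D (0::nat))"
    using D(2) by (intro DERIV_continuous_on) auto
  then show ?thesis by (rule continuous_on_eq) (use D in auto)
qed

lemma kernel_profile_continuous_norm:
  fixes T :: "'a::euclidean_space itself"
  assumes "kernel_profile T \<delta> r"
  shows "continuous_on UNIV (\<lambda>z::'a. r (norm z))"
  by (rule continuous_on_compose2[OF kernel_profile_continuous_on[OF assms]])
    (auto intro: continuous_intros)

lemma kernel_profile_borel_measurable: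
  fixes T :: "'a::euclidean_space itself"
  assumes "kernel_profile T \<delta> r"
  shows "(\<lambda>z::'a. r (norm z)) \<in> borel_measurable borel"
  by (rule borel_measurable_continuous_onI[OF kernel_profile_continuous_norm[OF assms]])

lemma kernel_mu_borel_measurable:
  fixes T :: "'a::euclidean_space itself"
  assumes "kernel_profile T \<delta> r"
  shows "(kernel_mu r :: 'a \<Rightarrow> real) \<in> borel_measurable borel"
  using kernel_profile_borel_measurable[OF assms] unfolding kernel_mu_def[abs_def] by measurable

text \<open>Integrability is hidden in the normalisation: a non-integrable function would have
  Bochner integral 0 instead of 1.\<close>

lemma kernel_profile_integral:
  fixes T :: "'a::euclidean_space itself"
  assumes "kernel_profile T \<delta> r"
  shows "integrable lborel (\<lambda>z::'a. r (norm z))" "(LINT z|lborel. r (norm (z::'a))) = 1"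
proof -
  have "(LINT z|lebesgue. r (norm (z::'a))) = 1" using assms by (simp add: kernel_profile_def)
  then show 1: "(LINT z|lborel. r (norm (z::'a))) = 1"
    by (subst (asm) integral_completion) (simp_all add: kernel_profile_borel_measurable[OF assms])
  then show "integrable lborel (\<lambda>z::'a. r (norm z))"
    using not_integrable_integral_eq by fastforce
qed

lemma kernel_profile_bounded:
  fixes T :: "'a::euclidean_space itself"
  assumes "kernel_profile T \<delta> r"
  obtains P where "P \<ge> 0" "\<And>z::'a. r (norm z) \<le> P"
proof -
  have "bounded (r ` {0..\<delta>})"
    by (intro compact_imp_bounded compact_continuous_image
        continuous_on_subset[OF kernel_profile_continuous_on[OF assms]]) auto
  then obtain P where P: "\<And>t. 0 \<le> t \<Longrightarrow> t \<le> \<delta> \<Longrightarrow> \<bar>r t\<bar> \<le> P"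
    unfolding bounded_real by fastforce
  have "r (norm z) \<le> max 0 P" for z :: 'a
    using P[of "norm z"] kernel_profile_eq_0[OF assms, of z] by (cases "norm z \<le> \<delta>") auto
  then show ?thesis by (intro that[of "max 0 P"]) auto
qed

lemma abs_kernel_mu_moment_le:
  assumes "kernel_profile T \<delta> r" "b \<in> Basis" "c \<in> Basis"
  shows "\<bar>(z \<bullet> b) * (z \<bullet> c) * kernel_mu r z\<bar> \<le> r (norm (z::'a::euclidean_space))"
proof (cases "z = 0")
  case False
  have "\<bar>z \<bullet> b\<bar> * \<bar>z \<bullet> c\<bar> \<le> norm z * norm z"
    using assms by (intro mult_mono Basis_le_norm) auto
  then have "\<bar>z \<bullet> b\<bar> * \<bar>z \<bullet> c\<bar> * kernel_mu r z \<le> norm z * norm z * kernel_mu r z"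
    by (rule mult_right_mono) (rule kernel_mu_nonneg[OF assms(1)])
  also have "\<dots> = r (norm z)" using False by (simp add: kernel_mu_def power2_eq_square)
  finally show ?thesis using kernel_mu_nonneg[OF assms(1), of z] by (simp add: abs_mult)
qed (use kernel_profile_nonneg[OF assms(1), of z] in simp)

text \<open>Reflecting the coordinate along \<open>b\<close> reverses the sign of an off-diagonal
  moment, and swapping two coordinates makes all diagonal ones equal. Their sum is the integral of
  \<open>r (norm z)\<close>, that is 1.\<close>

lemma kernel_mu_second_moment:
  fixes b c :: "'a::euclidean_space"
  assumes k: "kernel_profile TYPE('a) \<delta> r" and b: "b \<in> Basis" and c: "c \<in> Basis"
  shows "integrable lborel (\<lambda>z::'a. (z \<bullet> b) * (z \<bullet> c) * kernel_mu r z)" (is ?int)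
    and "(LINT z|lborel. (z \<bullet> b) * (z \<bullet> c) * kernel_mu r z) = (if b = c then 1 / real DIM('a) else 0)"
      (is "?I b c = _")
proof -
  note [measurable] = kernel_mu_borel_measurable[OF k]
  have int: "integrable lborel (\<lambda>z::'a. (z \<bullet> b) * (z \<bullet> c) * kernel_mu r z)"
    if "b \<in> Basis" "c \<in> Basis" for b c
    by (intro Bochner_Integration.integrable_bound[OF kernel_profile_integral(1)[OF k]] AE_I2)
      (auto intro: order_trans[OF abs_kernel_mu_moment_le[OF k that]])
  then show ?int using b c .
  have off: "?I b c = 0" if "b \<noteq> c"
  proof -
    let ?s = "\<lambda>j. if j = b then -1 else 1 :: real"
    let ?T = "\<lambda>z::'a. \<Sum>j\<in>Basis. (?s j * (z \<bullet> j)) *\<^sub>R j"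
    have nT: "norm (?T z) = norm z" for z
      by (subst (1 2) norm_eq_sqrt_inner, subst (1 2) euclidean_inner) (auto intro!: sum.cong arg_cong[of _ _ sqrt])
    have "?I b c = (LINT z|lborel. (?T z \<bullet> b) * (?T z \<bullet> c) * kernel_mu r (?T z))"
      by (rule lborel_integral_sign_change[symmetric]) auto
    also have "\<dots> = (LINT z|lborel. - ((z \<bullet> b) * (z \<bullet> c) * kernel_mu r z))"
      using that b c nT by (simp add: kernel_mu_def)
    also have "\<dots> = - ?I b c" by simp
    finally show ?thesis by simp
  qed
  have eq: "?I a a = ?I b b" if a: "a \<in> Basis" for a
  proof -
    let ?p = "Transposition.transpose a b"
    let ?T = "\<lambda>z::'a. \<Sum>j\<in>Basis. (z \<bullet> ?p j) *\<^sub>R j"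
    have p: "?p permutes Basis" using a b by (rule permutes_swap_id)
    have nT: "norm (?T z) = norm z" for z
    proof -
      have "(\<Sum>j\<in>Basis. (z \<bullet> ?p j) * (z \<bullet> ?p j)) = (\<Sum>j\<in>Basis. (z \<bullet> j) * (z \<bullet> j))"
        using sum.permute[OF p, of "\<lambda>j. (z \<bullet> j) * (z \<bullet> j)"] by (simp add: o_def)
      then show ?thesis
        by (subst (1 2) norm_eq_sqrt_inner, subst (1 2) euclidean_inner) simp
    qed
    have "?I a a = (LINT z|lborel. (?T z \<bullet> a) * (?T z \<bullet> a) * kernel_mu r (?T z))"
      by (rule lborel_integral_permute_Basis[OF _ p, symmetric]) auto
    also have "\<dots> = ?I b b"
      using a nT by (simp add: kernel_mu_def)
    finally show ?thesis .
  qed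
  have "(\<Sum>a\<in>Basis. ?I a a) = (LINT z|lborel. (\<Sum>a\<in>Basis. ((z::'a) \<bullet> a) * (z \<bullet> a) * kernel_mu r z))"
    by (subst Bochner_Integration.integral_sum) (use int in auto)
  also have "\<dots> = (LINT z|lborel. r (norm (z::'a)))"
  proof (rule integral_cong_AE)
    \<comment> \<open>The origin is excluded because \<open>kernel_mu r 0\<close> is 0 while
      \<open>r 0\<close> may be positive.\<close>
    have "AE z in lborel. z \<noteq> (0::'a)" by (rule AE_lborel_singleton)
    then show "AE z in lborel. (\<Sum>a\<in>Basis. (z \<bullet> a) * (z \<bullet> a) * kernel_mu r z) = r (norm (z::'a))"
    proof eventually_elim
      case (elim z)
      have "(\<Sum>a\<in>Basis. (z \<bullet> a) * (z \<bullet> a) * kernel_mu r z) = (norm z)\<^sup>2 * kernel_mu r z"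
        unfolding power2_norm_eq_inner euclidean_inner[of z z] by (simp add: sum_distrib_right)
      with elim show ?case by (simp add: kernel_mu_def)
    qed
  qed (use kernel_profile_borel_measurable[OF k] in auto)
  also have "\<dots> = 1" by (rule kernel_profile_integral(2)[OF k])
  finally have "real DIM('a) * ?I b b = 1" using eq by simp
  then show "?I b c = (if b = c then 1 / real DIM('a) else 0)"
    using off by (auto simp: field_simps)
qed

section \<open>Consistency of the nonlocal Laplacian\<close>

lemma nonlocal_laplacian_eq_lborel:
  fixes u :: "'a::euclidean_space \<Rightarrow> real"
  assumes k: "kernel_profile TYPE('a) \<delta> r" and \<Omega>: "open \<Omega>" and u: "continuous_on \<Omega> u"
  shows "(\<lambda>y. indicator \<Omega> y * ((u y - u x) * kernel_mu r (x - y))) \<in> borel_measurable borel"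
    and "nonlocal_laplacian \<sigma> \<Omega> (kernel_alpha r) u x
      = \<sigma> * (LINT y|lborel. indicator \<Omega> y * ((u y - u x) * kernel_mu r (x - y)))"
proof -
  note [measurable] = kernel_mu_borel_measurable[OF k]
  have [measurable]: "(\<lambda>y. indicator \<Omega> y * (u y - u x)) \<in> borel_measurable borel"
    by (intro borel_measurable_indicator_times_continuous_on \<Omega> continuous_intros u)
  have "(\<lambda>y. indicator \<Omega> y * (u y - u x) * kernel_mu r (x - y)) \<in> borel_measurable borel"
    by measurable
  then show 1: "(\<lambda>y. indicator \<Omega> y * ((u y - u x) * kernel_mu r (x - y))) \<in> borel_measurable borel"
    by (simp add: mult.assoc)
  show "nonlocal_laplacian \<sigma> \<Omega> (kernel_alpha r) u x
      = \<sigma> * (LINT y|lborel. indicator \<Omega> y * ((u y - u x) * kernel_mu r (x - y)))"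
    unfolding nonlocal_laplacian_def power2_norm_kernel_alpha[OF k]
      set_lebesgue_integral_eq_lborel[OF 1] ..
qed

lemma integral_dir_deriv_kernel_mu:
  fixes u :: "'a::euclidean_space \<Rightarrow> real"
  assumes k: "kernel_profile TYPE('a) \<delta> r"
  shows "integrable lborel (\<lambda>z. dir_deriv 2 z u x * kernel_mu r z)"
    and "real DIM('a) * (LINT z|lborel. dir_deriv 2 z u x * kernel_mu r z) = laplacian u x"
proof -
  have eq: "dir_deriv 2 z u x * kernel_mu r z
      = (\<Sum>b\<in>Basis. \<Sum>c\<in>Basis. iter_pderiv [c, b] u x * ((z \<bullet> b) * (z \<bullet> c) * kernel_mu r z))" for z
    unfolding dir_deriv_2 sum_distrib_right by (intro sum.cong refl) (simp only: mult_ac)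
  have int: "integrable lborel (\<lambda>z. iter_pderiv [c, b] u x * ((z \<bullet> b) * (z \<bullet> c) * kernel_mu r z))"
    if "b \<in> Basis" "c \<in> Basis" for b c
    by (rule integrable_mult_right) (use kernel_mu_second_moment(1)[OF k that] in auto)
  show "integrable lborel (\<lambda>z. dir_deriv 2 z u x * kernel_mu r z)"
    unfolding eq by (intro Bochner_Integration.integrable_sum int)
  have "(LINT z|lborel. dir_deriv 2 z u x * kernel_mu r z)
      = (\<Sum>b\<in>Basis. \<Sum>c\<in>Basis. LINT z|lborel. iter_pderiv [c, b] u x * ((z \<bullet> b) * (z \<bullet> c) * kernel_mu r z))"
    unfolding eq
    by (intro trans[OF Bochner_Integration.integral_sum] sum.cong refl Bochner_Integration.integral_sum
        Bochner_Integration.integrable_sum int)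
  also have "\<dots> = (\<Sum>b\<in>Basis. \<Sum>c\<in>Basis. iter_pderiv [c, b] u x * (if b = c then 1 / real DIM('a) else 0))"
    by (intro sum.cong refl) (simp add: kernel_mu_second_moment(2)[OF k] del: iter_pderiv.simps)
  also have "\<dots> = laplacian u x / real DIM('a)"
    by (simp add: laplacian_def if_distrib[of "\<lambda>t. _ * t"] sum_divide_distrib cong: if_cong)
  finally show "real DIM('a) * (LINT z|lborel. dir_deriv 2 z u x * kernel_mu r z) = laplacian u x"
    by simp
qed

text \<open>With sigma = 2d, the difference is d times the integral of G(z) + G(-z) - Q(z), where
  \<open>Q\<close> is the quadratic Taylor term. By the fourth-order estimate this integrand is at
  most d^4 M \<delta>^2 r(|z|), and \<open>r (norm z)\<close> has integral 1.\<close>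

lemma abs_nonlocal_laplacian_minus_laplacian_le:
  fixes u :: "'a::euclidean_space \<Rightarrow> real"
  assumes d: "DIM('a) \<ge> 2" and \<Omega>: "open \<Omega>" and C: "Ck_on 4 \<Omega> u"
    and M: "\<And>bs y. set bs \<subseteq> Basis \<Longrightarrow> length bs \<le> 4 \<Longrightarrow> y \<in> \<Omega> \<Longrightarrow> \<bar>iter_pderiv bs u y\<bar> \<le> M"
    and k: "kernel_profile TYPE('a) \<delta> r" and \<delta>: "\<delta> > 0" and ball: "ball x \<delta> \<subseteq> \<Omega>"
  shows "\<bar>scaled_nonlocal_laplacian \<Omega> r u x - laplacian u x\<bar> \<le> real DIM('a) ^ 5 * M * \<delta>\<^sup>2"
proof -
  note cu = Ck_on_imp_continuous_on[OF C]
  note mu0 = kernel_mu_nonneg[OF k]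
  have M0: "M \<ge> 0" using M[of "[]" x] ball \<delta> by force
  let ?h = "\<lambda>y. indicator \<Omega> y * ((u y - u x) * kernel_mu r (x - y))"
  \<comment> \<open>The integrand after the shift y = x + z. The kernel vanishes for |z| \<ge>
    \<delta>, so \<open>\<Omega>\<close> may be replaced by a ball, which is symmetric under z to
    -z.\<close>
  define G where "G z = indicator (ball 0 \<delta>) z * ((u (x + z) - u x) * kernel_mu r z)" for z
  have in\<Omega>: "x + t *\<^sub>R z \<in> \<Omega>" if "z \<in> ball 0 \<delta>" "\<bar>t\<bar> \<le> 1" for z t
  proof -
    have "\<bar>t\<bar> * norm z \<le> norm z" using mult_right_mono[OF that(2), of "norm z"] by simp
    then have "x + t *\<^sub>R z \<in> ball x \<delta>" using that by (simp add: dist_norm)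
    with ball show ?thesis by blast
  qed
  have hG: "?h (x + z) = G z" for z
    using kernel_mu_eq_0[OF k, of z] in\<Omega>[of z 1] by (cases "z \<in> ball 0 \<delta>") (auto simp: G_def)
  have hm [measurable]: "?h \<in> borel_measurable borel"
    by (rule nonlocal_laplacian_eq_lborel(1)[OF k \<Omega> cu])
  have Gm [measurable]: "G \<in> borel_measurable borel"
    unfolding hG[symmetric] by measurable
  have LG: "scaled_nonlocal_laplacian \<Omega> r u x = 2 * real DIM('a) * (LINT z|lborel. G z)"
    using lborel_integral_translate[OF hm, of x] unfolding hG
    by (simp add: nonlocal_laplacian_eq_lborel(2)[OF k \<Omega> cu])
  \<comment> \<open>\<open>P\<close> depends on the kernel; it provides an integrable majorant of
    order 1/|z| and stays out of the final estimate.\<close>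
  obtain P where P: "P \<ge> 0" "\<And>z::'a. r (norm z) \<le> P" by (rule kernel_profile_bounded[OF k]) blast
  have Gb: "\<bar>G z\<bar> \<le> real DIM('a) * M * P * (indicator (ball 0 \<delta>) z / norm z)" for z
  proof (cases "z \<in> ball 0 \<delta> \<and> z \<noteq> 0")
    case True
    have "\<bar>u (x + z) - u x\<bar> \<le> real DIM('a) * norm z * M"
      using True in\<Omega>[of z] M Ck_on_antimono[OF C, of 1]
      by (intro abs_diff_le_of_pderiv_bound[of \<Omega>]) auto
    moreover have "kernel_mu r z \<le> P / (norm z)\<^sup>2"
      unfolding kernel_mu_def by (intro divide_right_mono P) auto
    ultimately have "\<bar>u (x + z) - u x\<bar> * kernel_mu r z \<le> real DIM('a) * norm z * M * (P / (norm z)\<^sup>2)"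
      using M0 mu0 by (intro mult_mono) auto
    with True mu0[of z] show ?thesis
      by (simp add: G_def abs_mult power2_eq_square)
  qed (auto simp: G_def indicator_def)
  have Bi: "integrable lborel (\<lambda>z::'a. real DIM('a) * M * P * (indicator (ball 0 \<delta>) z / norm z))"
    by (intro integrable_mult_right integrable_inverse_norm_ball d)
  have Gb': "\<bar>G (- z)\<bar> \<le> real DIM('a) * M * P * (indicator (ball 0 \<delta>) z / norm z)" for z
    using Gb[of "- z"] by (simp add: indicator_def)
  have Gi: "integrable lborel G"
    by (rule Bochner_Integration.integrable_bound[OF Bi _ AE_I2])
      (simp, unfold real_norm_def, rule order_trans[OF Gb abs_ge_self])
  have Gi': "integrable lborel (\<lambda>z. G (- z))"
    by (rule Bochner_Integration.integrable_bound[OF Bi _ AE_I2])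
      (simp, unfold real_norm_def, rule order_trans[OF Gb' abs_ge_self])
  define Q where "Q z = dir_deriv 2 z u x * kernel_mu r z" for z
  have Qi: "integrable lborel Q" and Q: "real DIM('a) * (LINT z|lborel. Q z) = laplacian u x"
    unfolding Q_def[abs_def] using integral_dir_deriv_kernel_mu[OF k] by blast+
  have "\<bar>G z + G (- z) - Q z\<bar> \<le> real DIM('a) ^ 4 * M * \<delta>\<^sup>2 * r (norm z)" for z
  proof (cases "z \<in> ball 0 \<delta> \<and> z \<noteq> 0")
    case True
    have "G z + G (- z) - Q z = (u (x + z) + u (x - z) - 2 * u x - dir_deriv 2 z u x) * kernel_mu r z"
      using True by (simp add: G_def Q_def algebra_simps)
    then have "\<bar>G z + G (- z) - Q z\<bar> = \<bar>u (x + z) + u (x - z) - 2 * u x - dir_deriv 2 z u x\<bar> * kernel_mu r z"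
      using mu0[of z] by (simp add: abs_mult)
    also have "\<dots> \<le> (real DIM('a) * norm z) ^ 4 * M * kernel_mu r z"
      using True in\<Omega>[of z] M mu0 by (intro mult_right_mono abs_second_difference_le[OF C]) auto
    also have "\<dots> = real DIM('a) ^ 4 * M * (norm z)\<^sup>2 * r (norm z)"
      using True by (simp add: kernel_mu_def power_mult_distrib field_simps eval_nat_numeral)
    also have "\<dots> \<le> real DIM('a) ^ 4 * M * \<delta>\<^sup>2 * r (norm z)"
      using True M0 kernel_profile_nonneg[OF k, of z] \<delta> by (intro mult_right_mono mult_left_mono power_mono) auto
    finally show ?thesis .
  next
    case False
    then have "G z + G (- z) - Q z = 0"
      using kernel_mu_eq_0[OF k, of z] by (auto simp: G_def Q_def kernel_mu_def)
    then show ?thesis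
      using M0 kernel_profile_nonneg[OF k, of z] by simp
  qed
  then have "(LINT z|lborel. \<bar>G z + G (- z) - Q z\<bar>)
      \<le> (LINT z|lborel. real DIM('a) ^ 4 * M * \<delta>\<^sup>2 * r (norm (z::'a)))"
    using Gi Gi' Qi kernel_profile_integral(1)[OF k] by (intro integral_mono) auto
  then have "\<bar>LINT z|lborel. G z + G (- z) - Q z\<bar> \<le> real DIM('a) ^ 4 * M * \<delta>\<^sup>2"
    using kernel_profile_integral(2)[OF k] by (intro order_trans[OF integral_abs_bound]) simp
  moreover have "(LINT z|lborel. G z + G (- z) - Q z) = 2 * (LINT z|lborel. G z) - (LINT z|lborel. Q z)"
    using Gi Gi' Qi lborel_integral_uminus[OF Gm] by simp
  ultimately have "real DIM('a) * \<bar>2 * (LINT z|lborel. G z) - (LINT z|lborel. Q z)\<bar>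
      \<le> real DIM('a) * (real DIM('a) ^ 4 * M * \<delta>\<^sup>2)"
    by (intro mult_left_mono) auto
  moreover have "scaled_nonlocal_laplacian \<Omega> r u x - laplacian u x
      = real DIM('a) * (2 * (LINT z|lborel. G z) - (LINT z|lborel. Q z))"
    using LG Q by (simp add: algebra_simps)
  ultimately show ?thesis
    by (simp add: abs_mult eval_nat_numeral mult_ac)
qed

section \<open>Convergence in \<open>L\<^sup>2\<close>\<close>

text \<open>A ball is connected: if it met both \<open>\<Omega>\<close> and the complement it would
  meet the frontier, at a distance below \<delta> from its centre.\<close>

lemma ball_subset_of_inner_domain:
  assumes "x \<in> inner_domain \<Omega> \<delta>"
  shows "ball x \<delta> \<subseteq> \<Omega>"
proof (rule ccontr)
  assume "\<not> ball x \<delta> \<subseteq> \<Omega>"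
  \<comment> \<open>The sign of \<delta> is not given, but a ball with a point outside
    \<open>\<Omega>\<close> is nonempty, so it contains its centre.\<close>
  moreover from this have "x \<in> ball x \<delta> \<inter> \<Omega>"
    using assms by (auto simp: inner_domain_def intro: le_less_trans[OF zero_le_dist])
  ultimately have "ball x \<delta> \<inter> frontier \<Omega> \<noteq> {}"
    by (intro connected_Int_frontier connected_ball) blast+
  then obtain p where "p \<in> frontier \<Omega>" "dist x p < \<delta>" by auto
  with infdist_le[of p "frontier \<Omega>" x] assms show False by (simp add: inner_domain_def)
qed

text \<open>A continuous function is its own weak partner. This allows a supremum over all points to
  be compared with an essential supremum.\<close>

lemma continuous_abs_le_Linfty_norm:
  fixes f :: "'a::euclidean_space \<Rightarrow> real"
  assumes \<Omega>: "open \<Omega>" and f: "continuous_on \<Omega> f" and x: "x \<in> \<Omega>"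
  shows "ennreal \<bar>f x\<bar> \<le> Linfty_norm \<Omega> f"
proof (cases "Linfty_norm \<Omega> f = top")
  case False
  have "f \<in> borel_measurable (lebesgue_on \<Omega>)"
    using \<Omega> f by (intro continuous_imp_measurable_on_sets_lebesgue) (auto simp: lborelD)
  with False have g: "f \<in> Linfty \<Omega>" by (simp add: Linfty_def top.not_eq_extremum)
  have "\<bar>f x\<bar> \<le> enn2real (Linfty_norm \<Omega> f)"
  proof (rule abs_le_Linfty_norm_of_weak_eq[OF \<Omega> f g _ x])
    fix \<phi> :: "'a \<Rightarrow> real"
    assume "test_function \<Omega> \<phi>"
    then have "Ck_on 0 UNIV \<phi>" unfolding test_function_def by blast
    then have "continuous_on \<Omega> \<phi>" using continuous_on_subset by auto
    then show "(LINT x|lborel. indicator \<Omega> x * (f x * \<phi> x)) = (LINT x:\<Omega>|lebesgue. f x * \<phi> x)"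
      by (intro set_lebesgue_integral_eq_lborel[symmetric] borel_measurable_indicator_times_continuous_on
          \<Omega> continuous_intros f)
  qed
  then have "ennreal \<bar>f x\<bar> \<le> ennreal (enn2real (Linfty_norm \<Omega> f))" by (rule ennreal_leI)
  also have "\<dots> = Linfty_norm \<Omega> f" using False by (simp add: top.not_eq_extremum)
  finally show ?thesis .
qed simp

text \<open>Extending \<open>u\<close> by zero makes the integrand jointly Borel in both variables,
  so the parametrised integral is Borel; it agrees with the operator on
  \<open>\<Omega>\<close>.\<close>

lemma nonlocal_laplacian_measurable:
  fixes u :: "'a::euclidean_space \<Rightarrow> real"
  assumes k: "kernel_profile TYPE('a) \<delta> r" and \<Omega>: "open \<Omega>" and u: "continuous_on \<Omega> u"
  shows "nonlocal_laplacian \<sigma> \<Omega> (kernel_alpha r) u \<in> borel_measurable (lebesgue_on \<Omega>)"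
proof -
  note [measurable] = kernel_mu_borel_measurable[OF k]
  define v where "v y = indicator \<Omega> y * u y" for y
  have [measurable]: "v \<in> borel_measurable borel"
    unfolding v_def[abs_def] by (rule borel_measurable_indicator_times_continuous_on[OF \<Omega> u])
  have [measurable]: "\<Omega> \<in> sets borel" using \<Omega> by simp
  define L where "L x = \<sigma> * (LINT y|lborel. indicator \<Omega> y * ((v y - v x) * kernel_mu r (x - y)))" for x
  have "L \<in> borel_measurable borel" unfolding L_def[abs_def] by measurable
  then have "L \<in> borel_measurable lebesgue" by (simp add: measurable_completion)
  then have "L \<in> borel_measurable (lebesgue_on \<Omega>)" by (rule measurable_restrict_space1)
  moreover have "nonlocal_laplacian \<sigma> \<Omega> (kernel_alpha r) u x = L x" if "x \<in> \<Omega>" for x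
    unfolding nonlocal_laplacian_eq_lborel(2)[OF k \<Omega> u] L_def
    by (intro arg_cong[of _ _ "\<lambda>t. \<sigma> * t"] Bochner_Integration.integral_cong)
      (use that in \<open>auto simp: v_def indicator_def\<close>)
  ultimately show ?thesis
    by (subst measurable_cong[of _ _ L]) auto
qed

lemma inner_domain_borel:
  assumes "open \<Omega>"
  shows "inner_domain \<Omega> \<delta> \<in> sets borel"
proof -
  have "open {x. \<delta> < infdist x (frontier \<Omega>)}"
    by (intro open_Collect_less continuous_intros)
  moreover have "inner_domain \<Omega> \<delta> = \<Omega> \<inter> {x. \<delta> < infdist x (frontier \<Omega>)}"
    by (auto simp: inner_domain_def)
  ultimately show ?thesis using assms by auto
qed

lemma L2_of_bounded:
  fixes f :: "'a::euclidean_space \<Rightarrow> real"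
  assumes "\<Omega> \<in> lmeasurable" "f \<in> borel_measurable (lebesgue_on \<Omega>)" "\<And>x. x \<in> \<Omega> \<Longrightarrow> \<bar>f x\<bar> \<le> C"
  shows "f \<in> L2 \<Omega>"
proof -
  interpret finite_measure "lebesgue_on \<Omega>"
    using assms(1) by (rule finite_measure_lebesgue_on)
  have "integrable (lebesgue_on \<Omega>) (\<lambda>x. (f x)\<^sup>2)"
  proof (rule integrable_const_bound[where B="C\<^sup>2"])
    show "AE x in lebesgue_on \<Omega>. norm ((f x)\<^sup>2) \<le> C\<^sup>2"
      using assms(3) by (intro AE_I2) (auto simp flip: abs_le_square_iff intro: order_trans[OF _ abs_ge_self])
  qed (use assms(2) in auto)
  with assms(2) show ?thesis by (simp add: L2_def)
qed

text \<open>The limit is tested along sequences in (0, b), which dominated convergence can handle;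
  the constant (2C)^2 is integrable as \<open>\<Omega>\<close> has finite measure.\<close>

lemma converges_L2_of_bounded_pointwise:
  fixes f :: "real \<Rightarrow> 'a::euclidean_space \<Rightarrow> real"
  assumes \<Omega>: "\<Omega> \<in> lmeasurable" and b: "b > 0"
    and fm: "\<And>\<delta>. 0 < \<delta> \<Longrightarrow> f \<delta> \<in> borel_measurable (lebesgue_on \<Omega>)"
    and gm: "g \<in> borel_measurable (lebesgue_on \<Omega>)"
    and fC: "\<And>\<delta> x. 0 < \<delta> \<Longrightarrow> \<delta> < b \<Longrightarrow> x \<in> \<Omega> \<Longrightarrow> \<bar>f \<delta> x\<bar> \<le> C"
    and gC: "\<And>x. x \<in> \<Omega> \<Longrightarrow> \<bar>g x\<bar> \<le> C"
    and lim: "\<And>x. x \<in> \<Omega> \<Longrightarrow> ((\<lambda>\<delta>. f \<delta> x) \<longlongrightarrow> g x) (at_right 0)"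
  shows "converges_L2 \<Omega> f g"
  unfolding converges_L2_def
proof (intro conjI)
  interpret finite_measure "lebesgue_on \<Omega>"
    using \<Omega> by (rule finite_measure_lebesgue_on)
  show "g \<in> L2 \<Omega>" by (rule L2_of_bounded[OF \<Omega> gm gC])
  show "\<forall>\<^sub>F \<delta> in at_right 0. f \<delta> \<in> L2 \<Omega>"
    using b fm fC by (auto simp: eventually_at_right intro!: exI[of _ b] L2_of_bounded[OF \<Omega>])
  show "((\<lambda>\<delta>. L2_norm \<Omega> (\<lambda>x. f \<delta> x - g x)) \<longlongrightarrow> 0) (at_right 0)"
  proof (rule tendsto_at_right_sequentially[OF b])
    fix S :: "nat \<Rightarrow> real"
    assume S: "\<And>n. 0 < S n" "\<And>n. S n < b" "S \<longlonglongrightarrow> 0"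
    have "(\<lambda>n. LINT x|lebesgue_on \<Omega>. (f (S n) x - g x)\<^sup>2) \<longlonglongrightarrow> (LINT x|lebesgue_on \<Omega>. 0)"
    proof (rule integral_dominated_convergence)
      show "integrable (lebesgue_on \<Omega>) (\<lambda>x. (2 * C)\<^sup>2)" by simp
      show "AE x in lebesgue_on \<Omega>. (\<lambda>n. (f (S n) x - g x)\<^sup>2) \<longlonglongrightarrow> 0"
      proof (rule AE_I2)
        fix x assume "x \<in> space (lebesgue_on \<Omega>)"
        then have x: "x \<in> \<Omega>" by simp
        have "filterlim S (at_right 0) sequentially"
          using S(3) S(1)[THEN less_imp_neq, THEN not_sym] S(1) by (simp add: filterlim_at)
        then have "(\<lambda>n. f (S n) x) \<longlonglongrightarrow> g x"
          by (rule filterlim_compose[OF lim[OF x]])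
        then have "(\<lambda>n. (f (S n) x - g x)\<^sup>2) \<longlonglongrightarrow> (g x - g x)\<^sup>2"
          by (intro tendsto_intros)
        then show "(\<lambda>n. (f (S n) x - g x)\<^sup>2) \<longlonglongrightarrow> 0" by simp
      qed
      show "AE x in lebesgue_on \<Omega>. norm ((f (S n) x - g x)\<^sup>2) \<le> (2 * C)\<^sup>2" for n
      proof (rule AE_I2)
        fix x assume "x \<in> space (lebesgue_on \<Omega>)"
        then have x: "x \<in> \<Omega>" by simp
        have "\<bar>f (S n) x - g x\<bar> \<le> \<bar>2 * C\<bar>"
          using fC[OF S(1) S(2) x, of n] gC[OF x] by linarith
        then show "norm ((f (S n) x - g x)\<^sup>2) \<le> (2 * C)\<^sup>2"
          by (simp add: abs_le_square_iff)
      qed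
    qed (use fm[OF S(1)] gm in auto)
    then have "(\<lambda>n. sqrt (LINT x|lebesgue_on \<Omega>. (f (S n) x - g x)\<^sup>2)) \<longlonglongrightarrow> sqrt 0"
      by (intro tendsto_real_sqrt) simp
    then show "(\<lambda>n. L2_norm \<Omega> (\<lambda>x. f (S n) x - g x)) \<longlonglongrightarrow> 0"
      by (simp add: L2_norm_def)
  qed
qed

section \<open>Compactly supported functions near the boundary\<close>

lemma dist_frontier_gt_of_set_edist:
  assumes "ennreal \<delta> < set_edist A B / 2" "p \<in> A" "q \<in> B" "\<delta> > 0"
  shows "2 * \<delta> < dist p q"
proof -
  have "set_edist A B \<le> ennreal (dist p q)"
    unfolding set_edist_def using assms by (intro INF_lower2[of "(p, q)"]) auto
  then have "set_edist A B / 2 \<le> ennreal (dist p q) / 2" by (rule divide_right_mono_ennreal)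
  also have "\<dots> = ennreal (dist p q / 2)" by (simp add: divide_ennreal[symmetric])
  finally have "ennreal \<delta> < ennreal (dist p q / 2)" using assms(1) by (rule order.strict_trans2[rotated])
  then show ?thesis using assms(4) by (simp add: ennreal_less_iff)
qed

text \<open>Such an \<open>x\<close> lies within \<delta> of a frontier point, so every
  \<open>y\<close> seen by the kernel lies within 2 \<delta> of it, whereas the support stays
  farther away. This explains the factor 1/2 in the hypothesis.\<close>

lemma nonlocal_laplacian_eq_0_near_frontier:
  fixes u :: "'a::euclidean_space \<Rightarrow> real"
  assumes k: "kernel_profile TYPE('a) \<delta> r" and \<delta>: "\<delta> > 0" and \<Omega>: "bounded \<Omega>"
    and x: "x \<in> \<Omega>" "x \<notin> inner_domain \<Omega> \<delta>"
    and e: "ennreal \<delta> < set_edist (supp_on \<Omega> u) (frontier \<Omega>) / 2"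
  shows "nonlocal_laplacian \<sigma> \<Omega> (kernel_alpha r) u x = 0"
proof -
  \<comment> \<open>A nonempty bounded set is not the whole space; nonemptiness of the frontier
    ensures that the distance is attained.\<close>
  have "frontier \<Omega> \<noteq> {}"
    using x(1) \<Omega> not_bounded_UNIV by (auto simp: frontier_eq_empty)
  then obtain q where q: "q \<in> frontier \<Omega>" "infdist x (frontier \<Omega>) = dist x q"
    using infdist_attains_inf[of "frontier \<Omega>" x] frontier_closed by blast
  then have xq: "dist x q \<le> \<delta>" using x by (simp add: inner_domain_def)
  have u0: "u y = 0" if "y \<in> \<Omega>" "dist x y < \<delta>" for y
  proof (rule ccontr)
    assume "u y \<noteq> 0"
    with that have "y \<in> supp_on \<Omega> u"
      using closure_subset[of "{x \<in> \<Omega>. u x \<noteq> 0}"] by (auto simp: supp_on_def)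
    from dist_frontier_gt_of_set_edist[OF e this q(1) \<delta>] have "2 * \<delta> < dist y q" .
    with that(2) xq dist_triangle[of y q x] show False by (simp add: dist_commute)
  qed
  have "(u y - u x) * kernel_mu r (x - y) = 0" if "y \<in> \<Omega>" for y
  proof (cases "dist x y < \<delta>")
    case True
    with u0[OF that] u0[OF x(1)] \<delta> show ?thesis by simp
  next
    case False
    then show ?thesis using kernel_mu_eq_0[OF k, of "x - y"] by (simp add: dist_norm)
  qed
  then have "(LINT y:\<Omega>|lebesgue. (u y - u x) * kernel_mu r (x - y)) = (LINT y|(lebesgue :: 'a measure). 0)"
    unfolding set_lebesgue_integral_def
    by (intro Bochner_Integration.integral_cong) (auto simp: indicator_def)
  then show ?thesis
    by (simp add: nonlocal_laplacian_def power2_norm_kernel_alpha[OF k])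
qed

lemma set_edist_pos:
  fixes A B :: "'a::euclidean_space set"
  assumes "compact A" "closed B" "A \<inter> B = {}"
  obtains d where "d > 0" "ennreal d \<le> set_edist A B"
proof -
  obtain d where d: "d > 0" "\<forall>x\<in>A. \<forall>y\<in>B. d \<le> dist x y"
    using separate_compact_closed[OF assms] by blast
  then have "ennreal d \<le> set_edist A B"
    unfolding set_edist_def by (auto intro!: INF_greatest ennreal_leI)
  with d(1) show ?thesis by (rule that)
qed

theorem theorem5p1:
  fixes \<Omega> :: "'a::euclidean_space set" and u :: "'a \<Rightarrow> real"
  assumes "DIM('a) \<ge> 2"
    and "open \<Omega>" and "bounded \<Omega>" and "connected \<Omega>"
    and "Ck_on 4 \<Omega> u" and "u \<in> W_infty 4 \<Omega>"
  shows "\<exists>K>0. \<forall>\<rho> :: real \<Rightarrow> real \<Rightarrow> real.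
    (\<forall>\<delta>>0. kernel_profile TYPE('a) \<delta> (\<rho> \<delta>)) \<longrightarrow>
      (\<forall>\<delta>>0. \<forall>x. ball x \<delta> \<subseteq> \<Omega> \<longrightarrow>
         \<bar>scaled_nonlocal_laplacian \<Omega> (\<rho> \<delta>) u x - laplacian u x\<bar> \<le> K * \<delta>\<^sup>2) \<and>
      (\<forall>\<delta>>0. (SUP x\<in>inner_domain \<Omega> \<delta>. ennreal \<bar>scaled_nonlocal_laplacian \<Omega> (\<rho> \<delta>) u x\<bar>)
         \<le> Linfty_norm \<Omega> (laplacian u) + ennreal (K * \<delta>\<^sup>2)) \<and>
      converges_L2 \<Omega>
        (\<lambda>\<delta> x. indicator (inner_domain \<Omega> \<delta>) x * scaled_nonlocal_laplacian \<Omega> (\<rho> \<delta>) u x)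
        (laplacian u) \<and>
      (compactly_supported_in \<Omega> u \<longrightarrow>
         (\<forall>\<delta>>0. ennreal \<delta> < set_edist (supp_on \<Omega> u) (frontier \<Omega>) / 2 \<longrightarrow>
            (SUP x\<in>\<Omega>. ennreal \<bar>scaled_nonlocal_laplacian \<Omega> (\<rho> \<delta>) u x\<bar>)
              \<le> Linfty_norm \<Omega> (laplacian u)
                 + ennreal K * (set_edist (supp_on \<Omega> u) (frontier \<Omega>))\<^sup>2) \<and>
         converges_L2 \<Omega> (\<lambda>\<delta>. scaled_nonlocal_laplacian \<Omega> (\<rho> \<delta>) u) (laplacian u))"
proof -
  let ?\<Delta> = "laplacian u"
  let ?d = "real DIM('a)"
  note d = assms(1) and \<Omega> = assms(2) and bd = assms(3) and C = assms(5)
  note cu = Ck_on_imp_continuous_on[OF C]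
  obtain M where M0: "M \<ge> 0" and M: "\<And>bs y. set bs \<subseteq> Basis \<Longrightarrow> length bs \<le> 4 \<Longrightarrow> y \<in> \<Omega> \<Longrightarrow>
      \<bar>iter_pderiv bs u y\<bar> \<le> M"
    by (rule W_infty_pderivs_bounded[OF \<Omega> C assms(6)]) blast
  \<comment> \<open>\<open>M\<close> bounds all derivatives of \<open>u\<close> up to order four, so
    \<open>K\<close> is fixed before any kernel is chosen; the summand 1 makes it strictly
    positive.\<close>
  define K where "K = ?d ^ 5 * M + 1"
  have K: "K > 0" using M0 by (simp add: K_def add_nonneg_pos)
  have lm: "\<Omega> \<in> lmeasurable" using \<Omega> bd by (rule lmeasurable_open[rotated])
  have \<Delta>c: "continuous_on \<Omega> ?\<Delta>"
    unfolding laplacian_def[abs_def]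
    by (intro continuous_on_sum continuous_on_iter_pderiv[OF C]) auto
  have \<Delta>m: "?\<Delta> \<in> borel_measurable (lebesgue_on \<Omega>)"
    using \<Omega> \<Delta>c by (intro continuous_imp_measurable_on_sets_lebesgue) (auto simp: lborelD)
  have \<Delta>b: "\<bar>?\<Delta> x\<bar> \<le> ?d * M" if "x \<in> \<Omega>" for x
  proof -
    have "\<bar>?\<Delta> x\<bar> \<le> (\<Sum>b\<in>Basis. \<bar>iter_pderiv [b, b] u x\<bar>)"
      unfolding laplacian_def by (rule sum_abs)
    also have "\<dots> \<le> (\<Sum>b\<in>(Basis :: 'a set). M)"
      using that by (intro sum_mono M) auto
    finally show ?thesis by simp
  qed
  show ?thesis
  proof (intro exI[of _ K] conjI K allI impI)
    fix \<rho> :: "real \<Rightarrow> real \<Rightarrow> real"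
    assume "\<forall>\<delta>>0. kernel_profile TYPE('a) \<delta> (\<rho> \<delta>)"
    then have k: "\<And>\<delta>. \<delta> > 0 \<Longrightarrow> kernel_profile TYPE('a) \<delta> (\<rho> \<delta>)" by blast
    let ?L = "\<lambda>\<delta>. scaled_nonlocal_laplacian \<Omega> (\<rho> \<delta>) u"
    let ?I = "inner_domain \<Omega>"
    let ?e = "set_edist (supp_on \<Omega> u) (frontier \<Omega>)"
    have cons: "\<bar>?L \<delta> x - ?\<Delta> x\<bar> \<le> K * \<delta>\<^sup>2" if "\<delta> > 0" "ball x \<delta> \<subseteq> \<Omega>" for \<delta> x
    proof -
      have "\<bar>?L \<delta> x - ?\<Delta> x\<bar> \<le> ?d ^ 5 * M * \<delta>\<^sup>2"
        by (rule abs_nonlocal_laplacian_minus_laplacian_le[OF d \<Omega> C M k]) (use that in auto)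
      then show ?thesis by (simp add: K_def algebra_simps add_increasing)
    qed
    then show "\<And>\<delta> x. 0 < \<delta> \<Longrightarrow> ball x \<delta> \<subseteq> \<Omega> \<Longrightarrow> \<bar>?L \<delta> x - ?\<Delta> x\<bar> \<le> K * \<delta>\<^sup>2" .
    have inner\<Omega>: "x \<in> \<Omega>" if "x \<in> ?I \<delta>" for x \<delta> using that by (simp add: inner_domain_def)
    have consI: "\<bar>?L \<delta> x\<bar> \<le> \<bar>?\<Delta> x\<bar> + K * \<delta>\<^sup>2" if "\<delta> > 0" "x \<in> ?I \<delta>" for \<delta> x
      using cons[OF that(1) ball_subset_of_inner_domain[OF that(2)]] by linarith
    have supI: "ennreal \<bar>?L \<delta> x\<bar> \<le> Linfty_norm \<Omega> ?\<Delta> + ennreal (K * \<delta>\<^sup>2)" if "\<delta> > 0" "x \<in> ?I \<delta>" for \<delta> x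
    proof -
      have "ennreal \<bar>?L \<delta> x\<bar> \<le> ennreal \<bar>?\<Delta> x\<bar> + ennreal (K * \<delta>\<^sup>2)"
        using consI[OF that] K by (simp flip: ennreal_plus)
      also have "\<dots> \<le> Linfty_norm \<Omega> ?\<Delta> + ennreal (K * \<delta>\<^sup>2)"
        by (intro add_right_mono continuous_abs_le_Linfty_norm \<Omega> \<Delta>c inner\<Omega>[OF that(2)])
      finally show ?thesis .
    qed
    then show "\<And>\<delta>. 0 < \<delta> \<Longrightarrow> (SUP x\<in>?I \<delta>. ennreal \<bar>?L \<delta> x\<bar>) \<le> Linfty_norm \<Omega> ?\<Delta> + ennreal (K * \<delta>\<^sup>2)"
      by (intro SUP_least)
    have Lm: "?L \<delta> \<in> borel_measurable (lebesgue_on \<Omega>)" if "\<delta> > 0" for \<delta>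
      by (rule nonlocal_laplacian_measurable[OF k[OF that] \<Omega> cu])
    have Lb: "\<bar>?L \<delta> x\<bar> \<le> ?d * M + K" if "\<delta> > 0" "\<delta> < 1" "x \<in> ?I \<delta>" for \<delta> x
    proof -
      have "K * \<delta>\<^sup>2 \<le> K * 1" using that K by (intro mult_left_mono) (auto simp: power_le_one)
      with consI[OF that(1,3)] \<Delta>b[OF inner\<Omega>[OF that(3)]] show ?thesis by simp
    qed
    \<comment> \<open>Each point of \<open>\<Omega>\<close> has positive distance to the frontier
      and so enters the inner domain once \<delta> falls below it; from then on the indicator is
      1.\<close>
    have inI: "\<forall>\<^sub>F \<delta> in at_right 0. \<delta> > 0 \<and> x \<in> ?I \<delta>" if "x \<in> \<Omega>" for x
    proof -
      have ne: "frontier \<Omega> \<noteq> {}"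
        using that bd not_bounded_UNIV by (auto simp: frontier_eq_empty)
      have "x \<notin> frontier \<Omega>" using that \<Omega> by (simp add: frontier_def interior_open)
      then have "infdist x (frontier \<Omega>) > 0"
        using in_closed_iff_infdist_zero[OF frontier_closed ne, of x] infdist_nonneg[of x "frontier \<Omega>"] by simp
      then show ?thesis
        using that by (auto simp: eventually_at_right inner_domain_def)
    qed
    have lim: "((\<lambda>\<delta>. ?L \<delta> x) \<longlongrightarrow> ?\<Delta> x) (at_right 0)" if "x \<in> \<Omega>" for x
    proof (rule LIM_zero_cancel, rule Lim_null_comparison)
      show "\<forall>\<^sub>F \<delta> in at_right 0. norm (?L \<delta> x - ?\<Delta> x) \<le> K * \<delta>\<^sup>2"
        using inI[OF that] by eventually_elim (simp add: cons ball_subset_of_inner_domain)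
      show "((\<lambda>\<delta>. K * \<delta>\<^sup>2) \<longlongrightarrow> 0) (at_right 0)"
        by (auto intro!: tendsto_eq_intros)
    qed
    show "converges_L2 \<Omega> (\<lambda>\<delta> x. indicator (?I \<delta>) x * ?L \<delta> x) ?\<Delta>"
    proof (rule converges_L2_of_bounded_pointwise[OF lm zero_less_one _ \<Delta>m])
      show "(\<lambda>x. indicator (?I \<delta>) x * ?L \<delta> x) \<in> borel_measurable (lebesgue_on \<Omega>)" if "\<delta> > 0" for \<delta>
      proof (intro borel_measurable_times Lm that measurable_restrict_space1)
        show "(indicator (?I \<delta>) :: 'a \<Rightarrow> real) \<in> borel_measurable lebesgue"
          using inner_domain_borel[OF \<Omega>, of \<delta>] by (intro measurable_completion borel_measurable_indicator) simp
      qed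
      show "\<bar>indicator (?I \<delta>) x * ?L \<delta> x\<bar> \<le> ?d * M + K" if "0 < \<delta>" "\<delta> < 1" for \<delta> x
        using Lb[OF that, of x] M0 K by (simp add: indicator_def)
      show "\<bar>?\<Delta> x\<bar> \<le> ?d * M + K" if "x \<in> \<Omega>" for x
        using \<Delta>b[OF that] K by linarith
      show "((\<lambda>\<delta>. indicator (?I \<delta>) x * ?L \<delta> x) \<longlongrightarrow> ?\<Delta> x) (at_right 0)" if "x \<in> \<Omega>" for x
      proof (rule Lim_transform_eventually[OF lim[OF that]])
        show "\<forall>\<^sub>F \<delta> in at_right 0. ?L \<delta> x = indicator (?I \<delta>) x * ?L \<delta> x"
          using inI[OF that] by eventually_elim simp
      qed
    qed
    have L0: "?L \<delta> x = 0" if "\<delta> > 0" "ennreal \<delta> < ?e / 2" "x \<in> \<Omega>" "x \<notin> ?I \<delta>" for \<delta> x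
      by (rule nonlocal_laplacian_eq_0_near_frontier[OF k[OF that(1)] that(1) bd that(3,4,2)])
    show "(SUP x\<in>\<Omega>. ennreal \<bar>?L \<delta> x\<bar>) \<le> Linfty_norm \<Omega> ?\<Delta> + ennreal K * ?e\<^sup>2"
      if "\<delta> > 0" "ennreal \<delta> < ?e / 2" for \<delta>
    proof (rule SUP_least)
      fix x assume x: "x \<in> \<Omega>"
      show "ennreal \<bar>?L \<delta> x\<bar> \<le> Linfty_norm \<Omega> ?\<Delta> + ennreal K * ?e\<^sup>2"
      proof (cases "x \<in> ?I \<delta>")
        case True
        \<comment> \<open>Stated in \<open>ennreal\<close>, this covers an infinite distance too; it
          gives \<delta> \<le> \<open>?e\<close>, hence the passage from \<delta>^2 to
          \<open>?e\<^sup>2\<close>.\<close>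
        have "?e / 2 \<le> ?e" by (rule divide_le_posI_ennreal) (simp_all add: mult_2)
        with that(2) have "ennreal \<delta> \<le> ?e" by (meson less_imp_le order.strict_trans2)
        then have "ennreal (K * \<delta>\<^sup>2) \<le> ennreal K * ?e\<^sup>2"
          using that(1) K by (simp add: ennreal_mult ennreal_power[symmetric] mult_left_mono power_mono)
        with supI[OF that(1) True] show ?thesis by (meson add_left_mono order_trans)
      qed (simp add: L0 that x)
    qed
    show "converges_L2 \<Omega> ?L ?\<Delta>" if cs: "compactly_supported_in \<Omega> u"
    proof -
      have "supp_on \<Omega> u \<inter> frontier \<Omega> = {}"
        using cs \<Omega> by (auto simp: compactly_supported_in_def frontier_def interior_open)
      \<comment> \<open>As \<open>?e\<close> is infinite for u = 0, a positive real lower bound is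
        used in its place.\<close>
      then obtain e where e: "e > 0" "ennreal e \<le> ?e"
        using cs set_edist_pos[OF _ frontier_closed] by (metis compactly_supported_in_def)
      show ?thesis
      proof (rule converges_L2_of_bounded_pointwise[OF lm _ Lm \<Delta>m _ _ lim])
        \<comment> \<open>The bound 1 keeps K \<delta>^2 below \<open>K\<close> on the inner domain;
          e / 2 makes the operator vanish on the rest of \<open>\<Omega>\<close>.\<close>
        show "min 1 (e / 2) > 0" using e by simp
        show "\<bar>?L \<delta> x\<bar> \<le> ?d * M + K" if "0 < \<delta>" "\<delta> < min 1 (e / 2)" "x \<in> \<Omega>" for \<delta> x
        proof (cases "x \<in> ?I \<delta>")
          case False
          have "ennreal \<delta> < ennreal (e / 2)" using that by (simp add: ennreal_less_iff)
          also have "\<dots> = ennreal e / 2" using e by (simp add: divide_ennreal[symmetric])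
          also have "\<dots> \<le> ?e / 2" by (rule divide_right_mono_ennreal[OF e(2)])
          finally show ?thesis using L0[OF that(1) _ that(3) False] M0 K by simp
        qed (use Lb that in auto)
        show "\<bar>?\<Delta> x\<bar> \<le> ?d * M + K" if "x \<in> \<Omega>" for x
          using \<Delta>b[OF that] K by linarith
      qed
    qed
  qed
qed

end
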